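(* Let $B$ be a supersoluble brace, and let $p$ be the largest prime in $\pi(B,+)\cup\{2\}$. Let $\pi$ be the set of all primes $q$ with $q\le p$. Then $B$ is residually $\pi$-finite, i.e., the intersection of all ideals $I$ of $B$ such that $B/I$ is finite of order divisible only by primes in $\pi$ is $\{0\}$.
   Context: A brace (skew left brace) is a set $B$ with two binary operations $+$ and $\cdot$ such that $(B,+)$ and $(B,\cdot)$ are groups and $a(b+c)=ab-a+ac$ for all $a,b,c\in B$. $\lambda_a(b)=-a+ab$ defines a homomorphism $\lambda\colon(B,\cdot)\to\operatorname{Aut}(B,+)$. An ideal is a subset that is a subgroup of both groups, normal in both, and invariant under all $\lambda_b$; quotients by ideals are braces. $\operatorname{Soc}(B)=\operatorname{Ker}\lambda\cap Z(B,+)$. $B$ is supersoluble if there is a finite chain of ideals $\{0\}=I_0\le\dots\le I_n=B$ such that for each $i$, either $(I_{i+1}/I_i,+)$ is infinite cyclic and $I_{i+1}/I_i\le\operatorname{Soc}(B/I_i)$, or $I_{i+1}/I_i$ has prime order. $\pi(B,+)$ is the set of primes $r$ such that $(B,+)$ has an element of order $r$. *)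

theory Defs
  imports "HOL-Algebra.Algebra" "HOL-Computational_Algebra.Primes"
begin

text \<open>A (skew left) brace is given by two group structures A (the additive group,
  written multiplicatively in HOL-Algebra) and M (the multiplicative group)
  on the same carrier, satisfying a(b+c) = ab - a + ac.\<close>

definition brace :: "('a, 'm) monoid_scheme \<Rightarrow> ('a, 'n) monoid_scheme \<Rightarrow> bool" where
  "brace A M \<longleftrightarrow> group A \<and> group M \<and> carrier M = carrier A \<and>
     (\<forall>a\<in>carrier A. \<forall>b\<in>carrier A. \<forall>c\<in>carrier A.
        a \<otimes>\<^bsub>M\<^esub> (b \<otimes>\<^bsub>A\<^esub> c)
          = (a \<otimes>\<^bsub>M\<^esub> b) \<otimes>\<^bsub>A\<^esub> inv\<^bsub>A\<^esub> a \<otimes>\<^bsub>A\<^esub> (a \<otimes>\<^bsub>M\<^esub> c))"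

definition brace_lambda :: "('a, 'm) monoid_scheme \<Rightarrow> ('a, 'n) monoid_scheme \<Rightarrow> 'a \<Rightarrow> 'a \<Rightarrow> 'a" where
  "brace_lambda A M a b = inv\<^bsub>A\<^esub> a \<otimes>\<^bsub>A\<^esub> (a \<otimes>\<^bsub>M\<^esub> b)"

definition brace_ideal :: "('a, 'm) monoid_scheme \<Rightarrow> ('a, 'n) monoid_scheme \<Rightarrow> 'a set \<Rightarrow> bool" where
  "brace_ideal A M I \<longleftrightarrow> normal I A \<and> normal I M \<and>
     (\<forall>b\<in>carrier A. \<forall>x\<in>I. brace_lambda A M b x \<in> I)"

definition brace_socle :: "('a, 'm) monoid_scheme \<Rightarrow> ('a, 'n) monoid_scheme \<Rightarrow> 'a set" where
  "brace_socle A M = {x \<in> carrier A.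
      (\<forall>b\<in>carrier A. brace_lambda A M x b = b) \<and>
      (\<forall>b\<in>carrier A. x \<otimes>\<^bsub>A\<^esub> b = b \<otimes>\<^bsub>A\<^esub> x)}"

text \<open>The quotient brace B/I is (A Mod I, M Mod I); for an ideal I the additive and
  multiplicative cosets of I coincide, so both structures live on the same carrier.\<close>

definition supersoluble_brace :: "('a, 'm) monoid_scheme \<Rightarrow> ('a, 'n) monoid_scheme \<Rightarrow> bool" where
  "supersoluble_brace A M \<longleftrightarrow> brace A M \<and>
     (\<exists>(I :: nat \<Rightarrow> 'a set) n.
        I 0 = {\<one>\<^bsub>A\<^esub>} \<and> I n = carrier A \<and>
        (\<forall>i\<le>n. brace_ideal A M (I i)) \<and>
        (\<forall>i<n. I i \<subseteq> I (Suc i) \<and>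
           ((((A\<lparr>carrier := I (Suc i)\<rparr>) Mod (I i)) \<cong> integer_group \<and>
             (\<lambda>x. I i #>\<^bsub>A\<^esub> x) ` I (Suc i) \<subseteq> brace_socle (A Mod (I i)) (M Mod (I i)))
            \<or> Factorial_Ring.prime (card ((\<lambda>x. I i #>\<^bsub>A\<^esub> x) ` I (Suc i))))))"

definition add_prime_spectrum :: "('a, 'm) monoid_scheme \<Rightarrow> nat set" where
  "add_prime_spectrum A = {r. Factorial_Ring.prime r \<and> (\<exists>x\<in>carrier A. group.ord A x = r)}"

end

(* Call a factor of a chain of ideals small if it has at most p elements. A factor of prime order
   r > p can be moved below a small factor (in a group of order c r with c < r the elements of order
   r form a characteristic subgroup) and below an infinite cyclic factor, unless it is absorbed by
   the latter. Pushed down to 0 it would produce an additive element of order r, so B has a chain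
   of ideals in which every factor is small or infinite cyclic and contained in the socle.
   An infinite cyclic factor above a small factor F can be moved to the bottom at the cost of
   further small factors: |F|! kills the permutations induced on the cosets of F, so suitable
   multiples of a generator lie in the socle of B. Once the infinite cyclic factor is at the
   bottom, its 2^n-multiples form, for large n, an ideal that avoids a given element, and the
   quotient of the infinite factor by it is again a succession of small factors. Induction on the
   number of infinite cyclic factors yields an ideal of finite index without prime divisors > p. *)

theory Submission
  imports Defs
begin

subsection \<open>Permutations and cyclic subgroups\<close>

text \<open>The spectrum of B does not control its quotients: the trivial brace on the integers has
  no torsion, yet Z/rZ is a quotient for every prime r. A factor of order r > p above an infinite
  cyclic one therefore need not come from an element of order r in B, and this forces the
  alternative between exchange and absorption. The prime 2 is adjoined to the spectrum for two
  reasons. Every r > p is then odd, so an automorphism of Z with trivial r-th power is trivial.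
  Moreover a step of index 2 inside an infinite cyclic factor counts as small, while the subgroups
  2^n Z meet in 0. An ideal has to be controlled in two groups and under \<open>lam\<close> at once.
  Statements about finite permutations are the common tool: translations and conjugations in either
  group and the maps \<open>lam\<close> are all treated as bijections whose iterates return to their
  starting point. Each exchange is proved over the ideal 0, where congruences become equations, and
  is then carried to an arbitrary bottom ideal by passing to the quotient.\<close>

lemma funpow_return:
  fixes f :: "'a \<Rightarrow> 'a"
  assumes "finite S" "inj_on f S" "f ` S \<subseteq> S" "x \<in> S"
  obtains k where "0 < k" "k \<le> card S" "(f ^^ k) x = x"
proof -
  have mem: "(f ^^ i) x \<in> S" for i
    using assms(3,4) by (induction i) auto
  \<comment> \<open>There are \<open>card S + 1\<close> exponents, so two iterates of
    \<open>x\<close> coincide. Injectivity then strips the common initial iterations, and the orbit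
    returns to \<open>x\<close> itself.\<close>
  have "\<not> inj_on (\<lambda>i. (f ^^ i) x) {..card S}"
  proof
    assume "inj_on (\<lambda>i. (f ^^ i) x) {..card S}"
    then have "card {..card S} \<le> card S"
      using card_inj_on_le[of "\<lambda>i. (f ^^ i) x" "{..card S}" S] mem assms(1) by blast
    then show False by simp
  qed
  then obtain i j where ij: "i < j" "j \<le> card S" "(f ^^ i) x = (f ^^ j) x"
    unfolding inj_on_def by (metis atMost_iff linorder_neqE_nat)
  have cancel: "(f ^^ i) u = (f ^^ i) v \<Longrightarrow> u = v" if "u \<in> S" "v \<in> S" for u v i
  proof (induction i)
    case (Suc i)
    have "(f ^^ i) w \<in> S" if "w \<in> S" for w
      using that assms(3) by (induction i) auto
    then show ?case using Suc assms(2) that by (auto dest: inj_onD)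
  qed simp
  have "(f ^^ j) x = (f ^^ i) ((f ^^ (j - i)) x)"
    using ij(1) by (metis comp_apply funpow_add le_add_diff_inverse less_imp_le)
  then have "(f ^^ (j - i)) x = x"
    using cancel[of "(f ^^ (j - i)) x" x i] mem[of "j - i"] assms(4) ij(3) by metis
  with ij that[of "j - i"] show thesis by auto
qed

lemma funpow_fixed_mult: "(f ^^ k) x = x \<Longrightarrow> (f ^^ (k * n)) x = x"
  by (induction n) (auto simp: funpow_add)

text \<open>Every return time is at most \<open>card S\<close> and so divides the factorial. The
  exponent depends on \<open>card S\<close> alone, which lets one multiple work for all points and
  all permutations.\<close>

lemma funpow_fact:
  assumes "finite S" "inj_on f S" "f ` S \<subseteq> S" "x \<in> S"
  shows "(f ^^ fact (card S)) x = x"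
proof -
  obtain k where k: "0 < k" "k \<le> card S" "(f ^^ k) x = x"
    using funpow_return[OF assms] by blast
  have "k dvd fact (card S)"
    using k(1,2) by (simp add: dvd_fact)
  then obtain n where "fact (card S) = k * n" ..
  then show ?thesis using funpow_fixed_mult[OF k(3)] by simp
qed

text \<open>The return time \<open>k\<close> of \<open>x\<close> is positive and below
  \<open>r\<close>, hence coprime to \<open>r\<close>. As both the \<open>k\<close>-th and the
  \<open>r\<close>-th iterate fix \<open>x\<close>, so does \<open>f\<close> by Bezout.\<close>

lemma funpow_prime_fixed:
  fixes r :: nat
  assumes "finite S" "inj_on f S" "f ` S \<subseteq> S" "x \<in> S"
    and r: "Factorial_Ring.prime r" "card S < r" and fr: "(f ^^ r) x = x"
  shows "f x = x"
proof -
  obtain k where k: "0 < k" "k \<le> card S" "(f ^^ k) x = x"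
    using funpow_return[OF assms(1-4)] by blast
  have "coprime k r"
    using k r by (metis coprime_commute nat_dvd_not_less order.strict_trans1 prime_imp_coprime)
  then obtain a b where ab: "k * a = Suc (r * b)"
    using k(1) bezout_nat[of k r] by (metis Suc_eq_plus1 coprime_imp_gcd_eq_1 nat_neq_iff)
  have "x = (f ^^ (k * a)) x" using funpow_fixed_mult[OF k(3)] by simp
  also have "\<dots> = f ((f ^^ (r * b)) x)" using ab by simp
  also have "\<dots> = f x" using funpow_fixed_mult[OF fr] by simp
  finally show ?thesis by simp
qed

text \<open>Here \<open>e\<close> will be the factor by which an element acts on an infinite cyclic
  ideal. Excluding -1 is what oddness of \<open>r\<close> is for.\<close>

lemma odd_power_eq_one:
  fixes e :: int
  assumes "e ^ r = 1" "odd r"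
  shows "e = 1"
proof -
  have "e dvd 1" using assms by (metis dvd_power odd_pos)
  then consider "e = 1" | "e = - 1" by (auto simp: zdvd1_eq abs_if split: if_splits)
  then show ?thesis using assms by cases auto
qed

context group
begin

lemma inv_cancel_left:
  assumes "x \<in> carrier G" "y \<in> carrier G"
  shows "inv x \<otimes> (x \<otimes> y) = y" "x \<otimes> (inv x \<otimes> y) = y"
  using assms by (simp_all flip: m_assoc)

text \<open>With \<open>H\<close> trivial this excludes r-torsion in a group killed by a number
  prime to r; with \<open>H\<close> an ideal it recovers an element from two coprime
  multiples.\<close>

lemma coprime_pow_mem:
  assumes "subgroup H G" "x \<in> carrier G" "x [^] (m::int) \<in> H" "x [^] (n::int) \<in> H" "coprime m n"
  shows "x \<in> H"
proof -
  obtain a b where ab: "a * m + b * n = 1"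
    using assms(5) by (metis bezout_int coprime_imp_gcd_eq_1)
  have "x = x [^] (a * m + b * n)" using ab assms(2) by simp
  also have "\<dots> = (x [^] m) [^] a \<otimes> (x [^] n) [^] b"
    using assms(2) by (simp add: int_pow_mult int_pow_pow mult.commute)
  also have "\<dots> \<in> H"
    using assms(1,3,4) by (meson subgroup.m_closed subgroup_int_pow_closed)
  finally show ?thesis .
qed

text \<open>Makes the orbit lemmas available for powers, by way of translations.\<close>

lemma mult_funpow: "x \<in> carrier G \<Longrightarrow> ((\<lambda>y. x \<otimes> y) ^^ n) \<one> = x [^] n"
proof (induction n)
  case (Suc n)
  have "x [^] Suc n = x \<otimes> x [^] n" using Suc.prems nat_pow_Suc2 by simp
  then show ?case using Suc by (simp del: nat_pow_Suc)
qed simp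

lemma conj_inj: "x \<in> carrier G \<Longrightarrow> inj_on (\<lambda>y. x \<otimes> y \<otimes> inv x) (carrier G)"
  by (auto intro!: inj_onI)

lemma subgroup_pow_card:
  assumes "subgroup H G" "finite H" "x \<in> H"
  shows "x [^] card H = \<one>"
proof -
  interpret H: group "G\<lparr>carrier := H\<rparr>" by (rule subgroup.subgroup_is_group[OF assms(1) is_group])
  have "x [^]\<^bsub>G\<lparr>carrier := H\<rparr>\<^esub> card H = \<one>"
    using H.pow_order_eq_1[of x] assms by (simp add: order_def)
  then show ?thesis unfolding nat_pow_consistent[of x "card H" H] .
qed

lemma prime_subgroup_cyclic:
  assumes H: "subgroup H G" "Factorial_Ring.prime (card H)" and x: "x \<in> H" "x \<noteq> \<one>" and w: "w \<in> H"
  shows "\<exists>k::int. w = x [^] k"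
proof -
  have xG: "x \<in> carrier G" using H(1) x(1) by (rule subgroup.mem_carrier)
  have fin: "finite H" using H(2) by (metis card.infinite not_prime_0)
  have "ord x dvd card H" using subgroup_pow_card[OF H(1) fin x(1)] pow_eq_id[OF xG] by blast
  moreover have "ord x \<noteq> 1" using ord_eq_1[OF xG] x(2) by blast
  ultimately have "card (generate G {x}) = card H"
    using H(2) generate_pow_card[OF xG] by (metis prime_nat_iff)
  moreover have "generate G {x} \<subseteq> H" using generate_subgroup_incl[OF _ H(1)] x(1) by blast
  ultimately have "generate G {x} = H" using card_subset_eq[OF fin] by blast
  then show ?thesis using w generate_pow[OF xG] by blast
qed

lemma conj_funpow:
  assumes "x \<in> carrier G" "y \<in> carrier G"
  shows "((\<lambda>b. x \<otimes> b \<otimes> inv x) ^^ n) y = x [^] n \<otimes> y \<otimes> inv (x [^] n)"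
proof (induction n)
  case (Suc n)
  have "x [^] Suc n = x \<otimes> x [^] n" using assms nat_pow_Suc2 by simp
  then show ?case using Suc assms by (simp add: m_assoc inv_mult_group del: nat_pow_Suc)
qed (use assms in simp)

end

subsection \<open>Ideals of braces\<close>

locale skew_brace =
  fixes A :: "('a, 'm) monoid_scheme" and M :: "('a, 'n) monoid_scheme"
  assumes brace: "brace A M"
begin

abbreviation plus (infixl "\<^bold>+" 65) where "x \<^bold>+ y \<equiv> x \<otimes>\<^bsub>A\<^esub> y"
abbreviation neg ("\<^bold>- _" [81] 80) where "\<^bold>- x \<equiv> inv\<^bsub>A\<^esub> x"
abbreviation zero ("\<^bold>0") where "\<^bold>0 \<equiv> \<one>\<^bsub>A\<^esub>"
abbreviation times (infixl "\<^bold>*" 70) where "x \<^bold>* y \<equiv> x \<otimes>\<^bsub>M\<^esub> y"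
abbreviation scale (infixr "\<^bold>\<cdot>" 75) where "k \<^bold>\<cdot> x \<equiv> x [^]\<^bsub>A\<^esub> (k::int)"
abbreviation C where "C \<equiv> carrier A"
abbreviation lam where "lam \<equiv> brace_lambda A M"
abbreviation ideal where "ideal \<equiv> brace_ideal A M"

sublocale add: group A using brace by (simp add: brace_def)
sublocale mult: group M using brace by (simp add: brace_def)

lemma carrier_M [simp]: "carrier M = C" using brace by (simp add: brace_def)

lemma brace_distrib:
  "a \<in> C \<Longrightarrow> b \<in> C \<Longrightarrow> c \<in> C \<Longrightarrow> a \<^bold>* (b \<^bold>+ c) = (a \<^bold>* b) \<^bold>+ \<^bold>- a \<^bold>+ (a \<^bold>* c)"
  using brace unfolding brace_def by blast

lemma times_closed [simp, intro]: "a \<in> C \<Longrightarrow> b \<in> C \<Longrightarrow> a \<^bold>* b \<in> C"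
  using mult.m_closed by simp

lemma inv_M_closed [simp, intro]: "a \<in> C \<Longrightarrow> inv\<^bsub>M\<^esub> a \<in> C"
  using mult.inv_closed by simp

lemma pow_M_closed [simp, intro]: "a \<in> C \<Longrightarrow> a [^]\<^bsub>M\<^esub> (n::nat) \<in> C"
  using mult.nat_pow_closed by simp

lemmas add_simps = add.m_assoc add.inv_mult_group add.inv_cancel_left

text \<open>Distributivity with \<open>a\<close> the identity of \<open>M\<close> and b = c = 0
  leaves 0 = -a.\<close>

lemma one_M [simp]: "\<one>\<^bsub>M\<^esub> = \<^bold>0"
proof -
  have 1: "\<one>\<^bsub>M\<^esub> \<in> C" using mult.one_closed by simp
  have "\<one>\<^bsub>M\<^esub> \<^bold>* (\<^bold>0 \<^bold>+ \<^bold>0) = (\<one>\<^bsub>M\<^esub> \<^bold>* \<^bold>0) \<^bold>+ \<^bold>- \<one>\<^bsub>M\<^esub> \<^bold>+ (\<one>\<^bsub>M\<^esub> \<^bold>* \<^bold>0)"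
    using 1 by (intro brace_distrib) auto
  then have "\<^bold>0 = \<^bold>- \<one>\<^bsub>M\<^esub>" using 1 mult.l_one by simp
  then show ?thesis using 1 by (metis add.inv_inv add.inv_one)
qed

lemma times_zero [simp]: "a \<in> C \<Longrightarrow> a \<^bold>* \<^bold>0 = a" "a \<in> C \<Longrightarrow> \<^bold>0 \<^bold>* a = a"
  using mult.r_one mult.l_one by simp_all

lemma lam_closed [simp, intro]: "a \<in> C \<Longrightarrow> b \<in> C \<Longrightarrow> lam a b \<in> C"
  by (simp add: brace_lambda_def)

lemma times_eq: "a \<in> C \<Longrightarrow> b \<in> C \<Longrightarrow> a \<^bold>* b = a \<^bold>+ lam a b"
  by (simp add: brace_lambda_def add_simps)

lemma lam_add: "a \<in> C \<Longrightarrow> b \<in> C \<Longrightarrow> c \<in> C \<Longrightarrow> lam a (b \<^bold>+ c) = lam a b \<^bold>+ lam a c"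
  by (simp add: brace_lambda_def brace_distrib add_simps)

lemma lam_hom: "a \<in> C \<Longrightarrow> lam a \<in> hom A A"
  by (auto simp: hom_def lam_add)

lemma lam_zero [simp]: "a \<in> C \<Longrightarrow> lam a \<^bold>0 = \<^bold>0"
  by (simp add: brace_lambda_def)

lemma lam_zero_left [simp]: "a \<in> C \<Longrightarrow> lam \<^bold>0 a = a"
  by (simp add: brace_lambda_def)

lemma lam_neg: "a \<in> C \<Longrightarrow> b \<in> C \<Longrightarrow> lam a (\<^bold>- b) = \<^bold>- lam a b"
  using lam_hom[of a] group_hom.hom_inv[of A A "lam a"]
  by (simp add: group_hom_def group_hom_axioms_def add.is_group)

lemma lam_scale: "a \<in> C \<Longrightarrow> b \<in> C \<Longrightarrow> lam a (k \<^bold>\<cdot> b) = k \<^bold>\<cdot> lam a b"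
  using hom_int_pow[OF lam_hom] add.is_group by blast

text \<open>Both sides are what remains of abc, expanded as (ab)c and as a(bc), once ab is cancelled
  on the left.\<close>

lemma lam_times: "a \<in> C \<Longrightarrow> b \<in> C \<Longrightarrow> c \<in> C \<Longrightarrow> lam (a \<^bold>* b) c = lam a (lam b c)"
proof -
  assume c: "a \<in> C" "b \<in> C" "c \<in> C"
  have "a \<^bold>* b \<^bold>+ lam (a \<^bold>* b) c = a \<^bold>* b \<^bold>* c"
    using c by (simp add: times_eq[of "a \<^bold>* b"])
  also have "\<dots> = a \<^bold>* (b \<^bold>* c)" using c mult.m_assoc by simp
  also have "\<dots> = a \<^bold>+ lam a (b \<^bold>+ lam b c)" using c by (simp add: times_eq)
  also have "\<dots> = a \<^bold>* b \<^bold>+ lam a (lam b c)" using c by (simp add: times_eq lam_add add_simps)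
  finally show ?thesis using c by simp
qed

lemma lam_inv_cancel [simp]:
  assumes "a \<in> C" "b \<in> C"
  shows "lam a (lam (inv\<^bsub>M\<^esub> a) b) = b" "lam (inv\<^bsub>M\<^esub> a) (lam a b) = b"
  using assms mult.l_inv mult.r_inv by (simp_all flip: lam_times)

lemma lam_inj: "a \<in> C \<Longrightarrow> inj_on (lam a) C"
  by (metis inj_on_inverseI lam_inv_cancel(2))

lemma lam_pow: "a \<in> C \<Longrightarrow> b \<in> C \<Longrightarrow> lam (a [^]\<^bsub>M\<^esub> (n::nat)) b = (lam a ^^ n) b"
proof (induction n)
  case (Suc n)
  have "a [^]\<^bsub>M\<^esub> Suc n = a \<^bold>* a [^]\<^bsub>M\<^esub> n"
    using Suc.prems mult.nat_pow_Suc2 by simp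
  then show ?case using Suc by (simp add: lam_times del: mult.nat_pow_Suc)
qed simp

text \<open>Product and inverse in \<open>M\<close> can be written additively: ab is a +
  \<open>lam\<close> a b, and the inverse of a is minus the image of a under \<open>lam\<close> of
  that inverse. The last hypothesis is separate because the inverse is not yet known to lie in
  \<open>H\<close>.\<close>

lemma left_ideal_subgroup_M:
  assumes "subgroup H A" "\<And>b x. b \<in> H \<Longrightarrow> x \<in> H \<Longrightarrow> lam b x \<in> H"
    and "\<And>x. x \<in> H \<Longrightarrow> lam (inv\<^bsub>M\<^esub> x) x \<in> H"
  shows "subgroup H M"
proof (rule mult.subgroupI)
  have HC: "x \<in> C" if "x \<in> H" for x using that assms(1) by (metis subgroup.mem_carrier)
  show "H \<subseteq> carrier M" using HC by auto
  show "H \<noteq> {}" using assms(1) subgroup.one_closed by blast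
  show "a \<^bold>* b \<in> H" if "a \<in> H" "b \<in> H" for a b
    using that assms(1,2) HC by (simp add: times_eq subgroup.m_closed)
  show "inv\<^bsub>M\<^esub> a \<in> H" if "a \<in> H" for a
  proof -
    have "inv\<^bsub>M\<^esub> a \<^bold>+ lam (inv\<^bsub>M\<^esub> a) a = \<^bold>0"
      using HC[OF that] mult.l_inv by (simp flip: times_eq)
    then have "inv\<^bsub>M\<^esub> a = \<^bold>- lam (inv\<^bsub>M\<^esub> a) a"
      using HC[OF that] by (metis add.inv_equality inv_M_closed lam_closed)
    then show ?thesis using assms(1,3) that by (metis subgroup.m_inv_closed)
  qed
qed

lemma idealI:
  assumes "subgroup H A"
    and lam: "\<And>b x. b \<in> C \<Longrightarrow> x \<in> H \<Longrightarrow> lam b x \<in> H"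
    and "\<And>b x. b \<in> C \<Longrightarrow> x \<in> H \<Longrightarrow> b \<^bold>+ x \<^bold>+ \<^bold>- b \<in> H"
    and "\<And>b x. b \<in> C \<Longrightarrow> x \<in> H \<Longrightarrow> b \<^bold>* x \<^bold>* inv\<^bsub>M\<^esub> b \<in> H"
  shows "ideal H"
proof -
  have HC: "x \<in> C" if "x \<in> H" for x using that assms(1) by (metis subgroup.mem_carrier)
  have "subgroup H M" using assms(1) HC by (auto intro!: left_ideal_subgroup_M lam)
  then show ?thesis
    using assms unfolding brace_ideal_def add.normal_inv_iff mult.normal_inv_iff by auto
qed

lemma idealD:
  assumes "ideal K"
  shows "subgroup K A" "subgroup K M" "K \<lhd> A" "K \<lhd> M" "K \<subseteq> C" "\<^bold>0 \<in> K"
    and "\<And>b x. b \<in> C \<Longrightarrow> x \<in> K \<Longrightarrow> lam b x \<in> K"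
    and "\<And>b x. b \<in> C \<Longrightarrow> x \<in> K \<Longrightarrow> b \<^bold>+ x \<^bold>+ \<^bold>- b \<in> K"
    and "\<And>b x. b \<in> C \<Longrightarrow> x \<in> K \<Longrightarrow> \<^bold>- b \<^bold>+ x \<^bold>+ b \<in> K"
    and "\<And>b x. b \<in> C \<Longrightarrow> x \<in> K \<Longrightarrow> b \<^bold>* x \<^bold>* inv\<^bsub>M\<^esub> b \<in> K"
    and "\<And>x y. x \<in> K \<Longrightarrow> y \<in> K \<Longrightarrow> x \<^bold>+ y \<in> K"
    and "\<And>x. x \<in> K \<Longrightarrow> \<^bold>- x \<in> K"
    and "\<And>x k. x \<in> K \<Longrightarrow> k \<^bold>\<cdot> x \<in> K"
    and "\<And>x. x \<in> K \<Longrightarrow> x \<in> C"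
    and "\<And>x y. x \<in> K \<Longrightarrow> y \<in> K \<Longrightarrow> x \<^bold>* y \<in> K"
    and "\<And>x n. x \<in> K \<Longrightarrow> x [^]\<^bsub>M\<^esub> (n::nat) \<in> K"
proof -
  note * = assms[unfolded brace_ideal_def add.normal_inv_iff mult.normal_inv_iff]
  show sA: "subgroup K A" and sM: "subgroup K M" using * by auto
  show KC: "K \<subseteq> C" "\<And>x. x \<in> K \<Longrightarrow> x \<in> C" using sA subgroup.subset by auto
  show "K \<lhd> A" "K \<lhd> M" using assms by (auto simp: brace_ideal_def)
  show "\<^bold>0 \<in> K" using sA subgroup.one_closed by blast
  show "lam b x \<in> K" if "b \<in> C" "x \<in> K" for b x using that * by auto
  show n: "b \<^bold>+ x \<^bold>+ \<^bold>- b \<in> K" if "b \<in> C" "x \<in> K" for b x using that * by auto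
  show "\<^bold>- b \<^bold>+ x \<^bold>+ b \<in> K" if "b \<in> C" "x \<in> K" for b x
    using n[of "\<^bold>- b" x] that by simp
  show "b \<^bold>* x \<^bold>* inv\<^bsub>M\<^esub> b \<in> K" if "b \<in> C" "x \<in> K" for b x using that * by auto
  show "x \<^bold>+ y \<in> K" if "x \<in> K" "y \<in> K" for x y using that sA by (simp add: subgroup.m_closed)
  show "\<^bold>- x \<in> K" if "x \<in> K" for x using that sA by (simp add: subgroup.m_inv_closed)
  show "k \<^bold>\<cdot> x \<in> K" if "x \<in> K" for x k using that sA by (simp add: add.subgroup_int_pow_closed)
  show m: "x \<^bold>* y \<in> K" if "x \<in> K" "y \<in> K" for x y using that sM by (simp add: subgroup.m_closed)
  show "x [^]\<^bsub>M\<^esub> (n::nat) \<in> K" if "x \<in> K" for x n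
    using that m \<open>\<^bold>0 \<in> K\<close> by (induction n) auto
qed

lemma diff_mem_swap:
  assumes "ideal K" "x \<in> C" "y \<in> C" "x \<^bold>+ \<^bold>- y \<in> K"
  shows "y \<^bold>+ \<^bold>- x \<in> K" "\<^bold>- y \<^bold>+ x \<in> K" "\<^bold>- x \<^bold>+ y \<in> K"
proof -
  show 1: "y \<^bold>+ \<^bold>- x \<in> K" using idealD(12)[OF assms(1,4)] assms(2,3) by (simp add: add_simps)
  show 2: "\<^bold>- y \<^bold>+ x \<in> K"
    using idealD(9)[OF assms(1,3,4)] assms(2,3) by (simp add: add_simps)
  show "\<^bold>- x \<^bold>+ y \<in> K"
    using idealD(12)[OF assms(1) 2] assms(2,3) by (simp add: add_simps)
qed

text \<open>Invariance concerns the maps \<open>lam\<close> on \<open>K\<close>; this is the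
  converse direction, that elements of \<open>K\<close> act trivially modulo \<open>K\<close>. It
  comes from normality in \<open>M\<close>: tb = bs with s in \<open>K\<close>, and both sides are
  expanded additively.\<close>

lemma ideal_lam_diff:
  assumes "ideal K" "t \<in> K" "b \<in> C"
  shows "lam t b \<^bold>+ \<^bold>- b \<in> K"
proof -
  have t: "t \<in> C" using assms idealD(14) by blast
  define s where "s = inv\<^bsub>M\<^esub> b \<^bold>* t \<^bold>* b"
  have s: "s \<in> K" using idealD(10)[OF assms(1), of "inv\<^bsub>M\<^esub> b" t] assms by (simp add: s_def)
  have sC: "s \<in> C" using s assms idealD(14) by blast
  have "b \<^bold>* s = t \<^bold>* b"
    using t assms(3) mult.inv_cancel_left mult.m_assoc by (simp add: s_def)
  then have "b \<^bold>+ lam b s = t \<^bold>+ lam t b" using t sC assms(3) by (simp add: times_eq)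
  then have "lam t b \<^bold>+ \<^bold>- b = \<^bold>- t \<^bold>+ (b \<^bold>+ lam b s \<^bold>+ \<^bold>- b)"
    using t sC assms(3) by (simp add: add_simps)
  also have "\<dots> \<in> K"
    using assms s by (intro idealD(8,11,12,7)) auto
  finally show ?thesis .
qed

lemma ideal_commutator:
  assumes "ideal K" "t \<in> K" "b \<in> C"
  shows "t \<^bold>+ b \<^bold>+ \<^bold>- t \<^bold>+ \<^bold>- b \<in> K"
proof -
  have t: "t \<in> C" using assms idealD(14) by blast
  have "t \<^bold>+ (b \<^bold>+ \<^bold>- t \<^bold>+ \<^bold>- b) \<in> K" using assms by (intro idealD(8,11,12)) auto
  then show ?thesis using t assms(3) by (simp add: add_simps)
qed

lemma ideal_zero: "ideal {\<^bold>0}"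
  by (rule idealI) (use mult.r_inv add.triv_subgroup in auto)

lemma ideal_carrier: "ideal C"
  by (rule idealI) (auto intro: add.subgroup_self)

text \<open>This is what lets the two quotient groups share one carrier. One inclusion is
  \<open>ideal_lam_diff\<close> applied to kx = k + \<open>lam\<close> k x.\<close>

lemma coset_eq:
  assumes "ideal K" "x \<in> C"
  shows "K #>\<^bsub>M\<^esub> x = K #>\<^bsub>A\<^esub> x"
proof -
  note KC = idealD(14)[OF assms(1)]
  have "k \<^bold>* x \<in> K #>\<^bsub>A\<^esub> x" if "k \<in> K" for k
  proof -
    have "k \<^bold>* x = (k \<^bold>+ (lam k x \<^bold>+ \<^bold>- x)) \<^bold>+ x"
      using KC[OF that] assms(2) by (simp add: times_eq add_simps)
    then show ?thesis using that ideal_lam_diff[OF assms(1) that assms(2)] idealD(11)[OF assms(1)]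
      by (auto simp: r_coset_def)
  qed
  moreover have "k \<^bold>+ x \<in> K #>\<^bsub>M\<^esub> x" if "k \<in> K" for k
  proof -
    \<comment> \<open>\<open>s\<close> is the solution of xs = k + x; conjugation by
      \<open>x\<close> then brings it to the left side.\<close>
    define s where "s = lam (inv\<^bsub>M\<^esub> x) (\<^bold>- x \<^bold>+ k \<^bold>+ x)"
    have s: "s \<in> K" unfolding s_def by (intro idealD(7,9) that assms inv_M_closed)
    have "x \<^bold>* s = k \<^bold>+ x"
      using KC[OF s] KC[OF that] assms(2) by (simp add: times_eq) (simp add: s_def add_simps)
    moreover have "(x \<^bold>* s \<^bold>* inv\<^bsub>M\<^esub> x) \<^bold>* x = x \<^bold>* s"
      using KC[OF s] assms(2) mult.m_assoc mult.l_inv by simp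
    ultimately have "k \<^bold>+ x = (x \<^bold>* s \<^bold>* inv\<^bsub>M\<^esub> x) \<^bold>* x" by simp
    then show ?thesis using idealD(10)[OF assms(1,2) s] by (auto simp: r_coset_def)
  qed
  ultimately show ?thesis by (auto simp: r_coset_def)
qed

end

subsection \<open>Factors of chains of ideals\<close>

text \<open>Factors \<open>L / K\<close> are described elementwise in \<open>K\<close> and \<open>L\<close>, so that the descriptions pass to
  quotients and back. A small factor consists of at most \<open>p\<close> cosets; their number need not be
  prime, since being smaller than \<open>r\<close> is all that moving a factor of prime order \<open>r\<close> requires.\<close>

definition infinite_factor ::
    "('a, 'm) monoid_scheme \<Rightarrow> ('a, 'n) monoid_scheme \<Rightarrow> 'a set \<Rightarrow> 'a set \<Rightarrow> bool" where
  "infinite_factor A M K L \<longleftrightarrow> brace_ideal A M K \<and> brace_ideal A M L \<and> K \<subseteq> L \<and>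
     (\<exists>y\<in>L. (\<forall>z\<in>L. \<exists>k::int. z \<otimes>\<^bsub>A\<^esub> inv\<^bsub>A\<^esub> (y [^]\<^bsub>A\<^esub> k) \<in> K) \<and> (\<forall>k::int. y [^]\<^bsub>A\<^esub> k \<in> K \<longrightarrow> k = 0)) \<and>
     (\<forall>z\<in>L. \<forall>b\<in>carrier A. brace_lambda A M z b \<otimes>\<^bsub>A\<^esub> inv\<^bsub>A\<^esub> b \<in> K \<and>
        z \<otimes>\<^bsub>A\<^esub> b \<otimes>\<^bsub>A\<^esub> inv\<^bsub>A\<^esub> z \<otimes>\<^bsub>A\<^esub> inv\<^bsub>A\<^esub> b \<in> K)"

definition small_factor ::
    "nat \<Rightarrow> ('a, 'm) monoid_scheme \<Rightarrow> ('a, 'n) monoid_scheme \<Rightarrow> 'a set \<Rightarrow> 'a set \<Rightarrow> bool" where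
  "small_factor p A M K L \<longleftrightarrow> brace_ideal A M K \<and> brace_ideal A M L \<and> K \<subseteq> L \<and>
     (\<exists>S\<subseteq>carrier A. finite S \<and> card S \<le> p \<and> (\<forall>z\<in>L. \<exists>s\<in>S. z \<otimes>\<^bsub>A\<^esub> inv\<^bsub>A\<^esub> s \<in> K))"

text \<open>For \<open>r\<close> prime this says that \<open>L / K\<close> has order
  \<open>r\<close>: it is nontrivial, generated by each of its nonzero elements and of exponent
  \<open>r\<close>. The exponent is recorded in both groups because the torsion argument takes
  powers in both.\<close>

definition prime_factor ::
    "nat \<Rightarrow> ('a, 'm) monoid_scheme \<Rightarrow> ('a, 'n) monoid_scheme \<Rightarrow> 'a set \<Rightarrow> 'a set \<Rightarrow> bool" where
  "prime_factor r A M K L \<longleftrightarrow> brace_ideal A M K \<and> brace_ideal A M L \<and> K \<subseteq> L \<and> K \<noteq> L \<and>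
     (\<forall>z\<in>L. z [^]\<^bsub>A\<^esub> int r \<in> K \<and> z [^]\<^bsub>M\<^esub> r \<in> K) \<and>
     (\<forall>z\<in>L - K. \<forall>w\<in>L. \<exists>k::int. w \<otimes>\<^bsub>A\<^esub> inv\<^bsub>A\<^esub> (z [^]\<^bsub>A\<^esub> k) \<in> K)"

section \<open>Transfer of ideals and factors along brace epimorphisms\<close>

locale brace_epi = skew_brace A M + Q: skew_brace A' M'
  for A :: "('a, 'm) monoid_scheme" and M :: "('a, 'n) monoid_scheme"
    and A' :: "('b, 'k) monoid_scheme" and M' :: "('b, 'l) monoid_scheme" +
  fixes proj N
  assumes proj_hom: "proj \<in> hom A A'" "proj \<in> hom M M'" and proj_onto: "proj ` carrier A = carrier A'"
    and N: "brace_ideal A M N" and ker: "\<And>x. x \<in> carrier A \<Longrightarrow> proj x = \<one>\<^bsub>A'\<^esub> \<longleftrightarrow> x \<in> N"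
begin

lemma proj_closed [simp]: "x \<in> C \<Longrightarrow> proj x \<in> Q.C"
  using proj_onto by blast

lemma proj_simps:
  assumes "x \<in> C"
  shows "y \<in> C \<Longrightarrow> Q.plus (proj x) (proj y) = proj (x \<^bold>+ y)"
    "y \<in> C \<Longrightarrow> Q.times (proj x) (proj y) = proj (x \<^bold>* y)"
    "inv\<^bsub>A'\<^esub> proj x = proj (\<^bold>- x)"
    "Q.scale k (proj x) = proj (k \<^bold>\<cdot> x)"
    "proj x [^]\<^bsub>M'\<^esub> (n::nat) = proj (x [^]\<^bsub>M\<^esub> n)"
    "inv\<^bsub>M'\<^esub> proj x = proj (inv\<^bsub>M\<^esub> x)"
    "y \<in> C \<Longrightarrow> Q.lam (proj x) (proj y) = proj (lam x y)"
proof -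
  interpret PA: group_hom A A' proj by unfold_locales (rule proj_hom)
  interpret PM: group_hom M M' proj by unfold_locales (rule proj_hom)
  show "y \<in> C \<Longrightarrow> Q.plus (proj x) (proj y) = proj (x \<^bold>+ y)"
    "y \<in> C \<Longrightarrow> Q.times (proj x) (proj y) = proj (x \<^bold>* y)"
    "inv\<^bsub>A'\<^esub> proj x = proj (\<^bold>- x)"
    "Q.scale k (proj x) = proj (k \<^bold>\<cdot> x)"
    "proj x [^]\<^bsub>M'\<^esub> (n::nat) = proj (x [^]\<^bsub>M\<^esub> n)"
    "inv\<^bsub>M'\<^esub> proj x = proj (inv\<^bsub>M\<^esub> x)"
    "y \<in> C \<Longrightarrow> Q.lam (proj x) (proj y) = proj (lam x y)"
    using assms PM.hom_mult[of x] PM.hom_inv[of x] PM.hom_nat_pow[of x]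
    by (simp_all add: brace_lambda_def PA.hom_int_pow)
qed

lemma proj_zero: "Q.zero = proj \<^bold>0"
  using ker[of "\<^bold>0"] idealD(6)[OF N] by simp

lemma proj_eq_iff: "x \<in> C \<Longrightarrow> y \<in> C \<Longrightarrow> proj x = proj y \<longleftrightarrow> x \<^bold>+ \<^bold>- y \<in> N"
proof -
  assume xy: "x \<in> C" "y \<in> C"
  have "proj x = proj y \<longleftrightarrow> Q.plus (proj x) (Q.neg (proj y)) = Q.zero"
    using xy by (metis Q.add.inv_solve_right' Q.add.l_one Q.add.one_closed proj_closed)
  then show ?thesis using xy ker by (simp add: proj_simps)
qed

text \<open>An ideal above the kernel is a union of fibres. The descriptions of factors are built
  from such memberships, which is why they pass through \<open>proj\<close> in both
  directions.\<close>

lemma proj_mem_iff: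
  assumes "ideal K" "N \<subseteq> K" "x \<in> C"
  shows "proj x \<in> proj ` K \<longleftrightarrow> x \<in> K"
proof
  assume "proj x \<in> proj ` K"
  then obtain k where k: "k \<in> K" "proj x = proj k" by auto
  then have "x \<^bold>+ \<^bold>- k \<in> K" using proj_eq_iff assms idealD(14)[OF assms(1)] by auto
  then have "x \<^bold>+ \<^bold>- k \<^bold>+ k \<in> K" using k idealD(11)[OF assms(1)] by blast
  then show "x \<in> K" using assms k idealD(14)[OF assms(1)] by (simp add: add_simps)
qed auto

lemma ideal_proj:
  assumes "ideal K"
  shows "Q.ideal (proj ` K)"
proof (rule Q.idealI)
  note KC = idealD(14)[OF assms]
  show "subgroup (proj ` K) A'"
  proof (rule Q.add.subgroupI)
    show "proj ` K \<subseteq> carrier A'" using KC proj_closed by auto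
    show "proj ` K \<noteq> {}" using idealD(6)[OF assms] by auto
  qed (use KC idealD(11,12)[OF assms] in \<open>auto simp: proj_simps\<close>)
qed (use idealD(14)[OF assms] idealD(7,8,10)[OF assms] in
      \<open>auto simp: proj_onto[symmetric] proj_simps\<close>)

text \<open>An ideal constructed in a quotient returns as an ideal above \<open>N\<close> with the
  prescribed image, the form that the factor lemmas below accept.\<close>

lemma ideal_vimage:
  assumes "Q.ideal W"
  defines "K \<equiv> {x \<in> C. proj x \<in> W}"
  shows "ideal K" "N \<subseteq> K" "proj ` K = W"
proof -
  show "ideal K" unfolding K_def
  proof (rule idealI)
    show "subgroup {x \<in> C. proj x \<in> W} A"
      using Q.idealD(6,11,12)[OF assms(1)]
      by (intro add.subgroupI) (auto simp flip: proj_simps simp: proj_zero)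
  qed (use Q.idealD(7,8,10)[OF assms(1)] proj_closed in \<open>auto simp flip: proj_simps\<close>)
  show "N \<subseteq> K"
  proof
    fix x assume x: "x \<in> N"
    then have "proj x = proj \<^bold>0"
      using proj_eq_iff[of x "\<^bold>0"] idealD(14)[OF N x] by simp
    then show "x \<in> K" using Q.idealD(6)[OF assms(1)] idealD(14)[OF N x] by (simp add: K_def proj_zero)
  qed
  show "proj ` K = W"
    using Q.idealD(14)[OF assms(1)] by (auto simp: K_def proj_onto[symmetric])
qed

context
  fixes K L assumes K: "ideal K" "N \<subseteq> K" and L: "ideal L" "N \<subseteq> L"
begin

lemma proj_subset_iff: "proj ` K \<subseteq> proj ` L \<longleftrightarrow> K \<subseteq> L"
  using proj_mem_iff[OF L] idealD(14)[OF K(1)] by blast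

lemma KL_closed: "x \<in> K \<Longrightarrow> x \<in> C" "x \<in> L \<Longrightarrow> x \<in> C"
  using idealD(14) K L by blast+

lemma infinite_factor_proj:
  "infinite_factor A' M' (proj ` K) (proj ` L) \<longleftrightarrow> infinite_factor A M K L"
proof -
  have 1: "Q.plus (proj z) (Q.neg (Q.scale k (proj y))) \<in> proj ` K \<longleftrightarrow> z \<^bold>+ \<^bold>- (k \<^bold>\<cdot> y) \<in> K"
    if "z \<in> L" "y \<in> L" for z y k
    using that KL_closed by (simp add: proj_simps proj_mem_iff[OF K])
  have 2: "Q.scale k (proj y) \<in> proj ` K \<longleftrightarrow> k \<^bold>\<cdot> y \<in> K" if "y \<in> L" for y k
    using that KL_closed by (simp add: proj_simps proj_mem_iff[OF K])
  have 3: "Q.plus (Q.lam (proj z) (proj b)) (Q.neg (proj b)) \<in> proj ` K \<longleftrightarrow> lam z b \<^bold>+ \<^bold>- b \<in> K"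
    "Q.plus (Q.plus (Q.plus (proj z) (proj b)) (Q.neg (proj z))) (Q.neg (proj b)) \<in> proj ` K \<longleftrightarrow>
       z \<^bold>+ b \<^bold>+ \<^bold>- z \<^bold>+ \<^bold>- b \<in> K" if "z \<in> L" "b \<in> C" for z b
    using that KL_closed by (simp_all add: proj_simps proj_mem_iff[OF K])
  have "(\<exists>y\<in>proj ` L. (\<forall>z\<in>proj ` L. \<exists>k. Q.plus z (Q.neg (Q.scale k y)) \<in> proj ` K) \<and>
            (\<forall>k. Q.scale k y \<in> proj ` K \<longrightarrow> k = 0))
    \<longleftrightarrow> (\<exists>y\<in>L. (\<forall>z\<in>L. \<exists>k. z \<^bold>+ \<^bold>- (k \<^bold>\<cdot> y) \<in> K) \<and> (\<forall>k. k \<^bold>\<cdot> y \<in> K \<longrightarrow> k = 0))"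
    unfolding bex_simps ball_simps using 1 2 by (intro bex_cong refl) simp
  moreover have "(\<forall>z\<in>proj ` L. \<forall>b\<in>Q.C. Q.plus (Q.lam z b) (Q.neg b) \<in> proj ` K \<and>
            Q.plus (Q.plus (Q.plus z b) (Q.neg z)) (Q.neg b) \<in> proj ` K)
    \<longleftrightarrow> (\<forall>z\<in>L. \<forall>b\<in>C. lam z b \<^bold>+ \<^bold>- b \<in> K \<and> z \<^bold>+ b \<^bold>+ \<^bold>- z \<^bold>+ \<^bold>- b \<in> K)"
    unfolding proj_onto[symmetric] ball_simps using 3 by simp
  ultimately show ?thesis
    unfolding infinite_factor_def using K L ideal_proj proj_subset_iff by presburger
qed

lemma prime_factor_proj:
  "prime_factor r A' M' (proj ` K) (proj ` L) \<longleftrightarrow> prime_factor r A M K L"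
proof -
  have 1: "Q.scale k (proj y) \<in> proj ` K \<longleftrightarrow> k \<^bold>\<cdot> y \<in> K" if "y \<in> L" for y k
    using that KL_closed by (simp add: proj_simps proj_mem_iff[OF K])
  have 2: "proj y [^]\<^bsub>M'\<^esub> r \<in> proj ` K \<longleftrightarrow> y [^]\<^bsub>M\<^esub> r \<in> K" if "y \<in> L" for y
    using that KL_closed by (simp add: proj_simps proj_mem_iff[OF K])
  have 3: "Q.plus (proj w) (Q.neg (Q.scale k (proj z))) \<in> proj ` K \<longleftrightarrow> w \<^bold>+ \<^bold>- (k \<^bold>\<cdot> z) \<in> K"
    if "w \<in> L" "z \<in> L" for z w k
    using that KL_closed by (simp add: proj_simps proj_mem_iff[OF K])
  have "proj ` K = proj ` L \<longleftrightarrow> K = L"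
    using proj_mem_iff[OF K] proj_mem_iff[OF L] KL_closed by blast
  moreover have "proj ` L - proj ` K = proj ` (L - K)"
  proof -
    have "z \<in> K" if "z \<in> L" "k \<in> K" "proj z = proj k" for z k
      using that proj_mem_iff[OF K KL_closed(2)[OF that(1)]] by simp
    then show ?thesis by auto
  qed
  moreover have "(\<forall>z\<in>proj ` L. Q.scale (int r) z \<in> proj ` K \<and> z [^]\<^bsub>M'\<^esub> r \<in> proj ` K)
      \<longleftrightarrow> (\<forall>z\<in>L. int r \<^bold>\<cdot> z \<in> K \<and> z [^]\<^bsub>M\<^esub> r \<in> K)"
    by (simp only: ball_simps 1 2 cong: ball_cong)
  moreover have "(\<forall>z\<in>proj ` (L - K). \<forall>w\<in>proj ` L. \<exists>k. Q.plus w (Q.neg (Q.scale k z)) \<in> proj ` K)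
      \<longleftrightarrow> (\<forall>z\<in>L - K. \<forall>w\<in>L. \<exists>k. w \<^bold>+ \<^bold>- (k \<^bold>\<cdot> z) \<in> K)"
    by (simp only: ball_simps) (intro ball_cong refl ex_cong1 3; simp)
  ultimately show ?thesis
    unfolding prime_factor_def using K L ideal_proj proj_subset_iff by presburger
qed

lemma small_factor_proj:
  "small_factor p A' M' (proj ` K) (proj ` L) \<longleftrightarrow> small_factor p A M K L"
proof -
  have "(\<exists>S\<subseteq>carrier A'. finite S \<and> card S \<le> p \<and>
           (\<forall>z\<in>proj ` L. \<exists>s\<in>S. z \<otimes>\<^bsub>A'\<^esub> inv\<^bsub>A'\<^esub> s \<in> proj ` K))
       \<longleftrightarrow> (\<exists>S\<subseteq>C. finite S \<and> card S \<le> p \<and> (\<forall>z\<in>L. \<exists>s\<in>S. z \<^bold>+ \<^bold>- s \<in> K))"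
    (is "?l \<longleftrightarrow> ?r")
  proof
    assume ?l
    then obtain S where S: "S \<subseteq> proj ` C" "finite S" "card S \<le> p"
      "\<And>z. z \<in> L \<Longrightarrow> \<exists>s\<in>S. proj z \<otimes>\<^bsub>A'\<^esub> inv\<^bsub>A'\<^esub> s \<in> proj ` K"
      by (auto simp: proj_onto[symmetric])
    \<comment> \<open>One preimage is chosen for each element of \<open>S\<close>, so lifting does
      not enlarge the set of representatives.\<close>
    obtain T where T: "T \<subseteq> C" "inj_on proj T" "S = proj ` T"
      using S(1) by (meson subset_image_inj)
    have "finite T" "card T \<le> p" using S(2,3) T by (auto simp: card_image finite_image_iff)
    moreover have "\<exists>s\<in>T. z \<^bold>+ \<^bold>- s \<in> K" if "z \<in> L" for z
      using S(4)[OF that] that T(1) KL_closed unfolding T(3) by (auto simp: proj_simps proj_mem_iff[OF K] subset_eq)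
    ultimately show ?r using T(1) by blast
  next
    assume ?r
    then obtain S where S: "S \<subseteq> C" "finite S" "card S \<le> p" "\<And>z. z \<in> L \<Longrightarrow> \<exists>s\<in>S. z \<^bold>+ \<^bold>- s \<in> K"
      by auto
    have "\<exists>s\<in>proj ` S. z \<otimes>\<^bsub>A'\<^esub> inv\<^bsub>A'\<^esub> s \<in> proj ` K" if "z \<in> proj ` L" for z
    proof -
      obtain x s where "x \<in> L" "z = proj x" "s \<in> S" "x \<^bold>+ \<^bold>- s \<in> K" using \<open>z \<in> proj ` L\<close> S(4) by blast
      then have "z \<otimes>\<^bsub>A'\<^esub> inv\<^bsub>A'\<^esub> proj s \<in> proj ` K"
        using S(1) KL_closed by (auto simp: proj_simps subset_eq)
      then show ?thesis using \<open>s \<in> S\<close> by blast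
    qed
    moreover have "proj ` S \<subseteq> carrier A'" using S(1) by (auto simp: proj_onto[symmetric])
    moreover have "card (proj ` S) \<le> p" using S(2,3) card_image_le[of S proj] by linarith
    ultimately show ?l using S(2) by blast
  qed
  then show ?thesis by (simp add: small_factor_def K L ideal_proj proj_subset_iff)
qed

end

end

context skew_brace
begin

lemma eq_of_diff:
  assumes "x \<in> C" "y \<in> C" "x \<^bold>+ \<^bold>- y = \<^bold>0"
  shows "x = y"
proof -
  have "x = (x \<^bold>+ \<^bold>- y) \<^bold>+ y" using assms(1,2) by (simp add: add_simps)
  then show ?thesis using assms by simp
qed

lemma prime_factorD:
  assumes "prime_factor r A M K L"
  shows "ideal K" "ideal L" "K \<subseteq> L" "K \<noteq> L"
    and "\<And>z. z \<in> L \<Longrightarrow> int r \<^bold>\<cdot> z \<in> K" "\<And>z. z \<in> L \<Longrightarrow> z [^]\<^bsub>M\<^esub> r \<in> K"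
    and "\<And>z w. z \<in> L \<Longrightarrow> z \<notin> K \<Longrightarrow> w \<in> L \<Longrightarrow> \<exists>k. w \<^bold>+ \<^bold>- (k \<^bold>\<cdot> z) \<in> K"
  using assms unfolding prime_factor_def by blast+

lemma factor_ideals:
  "infinite_factor A M K L \<Longrightarrow> ideal K \<and> ideal L \<and> K \<subseteq> L"
  "small_factor p A M K L \<Longrightarrow> ideal K \<and> ideal L \<and> K \<subseteq> L"
  "prime_factor r A M K L \<Longrightarrow> ideal K \<and> ideal L \<and> K \<subseteq> L"
  by (auto simp: infinite_factor_def small_factor_def prime_factor_def)

text \<open>The common core of both exchanges with a prime factor: the r-torsion of \<open>K\<close>
  is a complement of \<open>H\<close> in \<open>K\<close>. Being cut out by an additive equation,
  \<open>T\<close> is invariant under \<open>lam\<close> and additive conjugation at once; closure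
  under conjugation in \<open>M\<close> is the real work. Commutation in \<open>M\<close> is
  demanded only for t with trivial r-th power in \<open>M\<close>, since the orbit argument of the
  callers starts from that; that every element of \<open>T\<close> is of this kind emerges inside
  the proof.\<close>

lemma torsion_ideal:
  assumes HK: "prime_factor r A M H K"
    and T_def: "T = {t \<in> K. int r \<^bold>\<cdot> t = \<^bold>0}"
    and tf: "\<forall>h\<in>H. int r \<^bold>\<cdot> h = \<^bold>0 \<longrightarrow> h = \<^bold>0" "\<forall>h\<in>H. h [^]\<^bsub>M\<^esub> r = \<^bold>0 \<longrightarrow> h = \<^bold>0"
    and commute: "\<forall>t\<in>T. \<forall>h\<in>H. t \<^bold>+ h = h \<^bold>+ t"
      "\<forall>t\<in>T. \<forall>h\<in>H. t [^]\<^bsub>M\<^esub> r = \<^bold>0 \<longrightarrow> t \<^bold>* h = h \<^bold>* t"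
    and ne: "T \<noteq> {\<^bold>0}"
  shows "ideal T" "prime_factor r A M {\<^bold>0} T" "\<And>w. w \<in> K \<Longrightarrow> \<exists>t\<in>T. w \<^bold>+ \<^bold>- t \<in> H"
proof -
  have comm: "t \<^bold>+ h = h \<^bold>+ t" "t [^]\<^bsub>M\<^esub> r = \<^bold>0 \<Longrightarrow> t \<^bold>* h = h \<^bold>* t"
    if "t \<in> T" "h \<in> H" for t h using commute that by auto
  note F = prime_factorD[OF HK]
  note Hi = idealD[OF F(1)] and Ki = idealD[OF F(2)]
  have TK: "t \<in> K" "int r \<^bold>\<cdot> t = \<^bold>0" if "t \<in> T" for t using that by (auto simp: T_def)
  have TC: "t \<in> C" if "t \<in> T" for t using TK(1)[OF that] Ki(14) by blast
  have HT: "t = \<^bold>0" if "t \<in> H" "t \<in> T" for t using that TK tf by blast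
  have scaleT: "k \<^bold>\<cdot> t \<in> T" if "t \<in> T" for t k
  proof -
    have "int r \<^bold>\<cdot> (k \<^bold>\<cdot> t) = k \<^bold>\<cdot> (int r \<^bold>\<cdot> t)"
      using TC[OF that] by (simp add: add.int_pow_pow mult.commute)
    then show ?thesis using TK[OF that] Ki(13) by (simp add: T_def)
  qed
  have "\<^bold>0 \<in> T" using Ki(6) by (simp add: T_def)
  then obtain t0 where t0: "t0 \<in> T" "t0 \<noteq> \<^bold>0" using ne by blast
  have t0C: "t0 \<in> C" and t0K: "t0 \<in> K" using t0 TC TK by auto
  have t0H: "t0 \<notin> H" using t0 HT by blast
  have dec: "\<exists>h\<in>H. \<exists>k. w = h \<^bold>+ k \<^bold>\<cdot> t0" if w: "w \<in> K" for w
  proof -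
    obtain k where "w \<^bold>+ \<^bold>- (k \<^bold>\<cdot> t0) \<in> H" using F(7)[OF t0K t0H w] by blast
    moreover have "w = (w \<^bold>+ \<^bold>- (k \<^bold>\<cdot> t0)) \<^bold>+ k \<^bold>\<cdot> t0"
      using Ki(14)[OF w] t0C by (simp add: add_simps)
    ultimately show ?thesis by blast
  qed
  have dec': "h = \<^bold>0" if "h \<in> H" "t \<in> T" "h \<^bold>+ t \<in> T" for h t
  proof -
    have "int r \<^bold>\<cdot> (h \<^bold>+ t) = int r \<^bold>\<cdot> h \<^bold>+ int r \<^bold>\<cdot> t"
      using that comm TC Hi(14) by (intro add.int_pow_mult_distrib) auto
    then show ?thesis using that TK tf Hi(14) by simp
  qed
  have Tcyc: "\<exists>k. t = k \<^bold>\<cdot> t0" if t: "t \<in> T" for t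
  proof -
    obtain h k where hk: "h \<in> H" "t = h \<^bold>+ k \<^bold>\<cdot> t0" using dec[OF TK(1)[OF t]] by blast
    then have "h = \<^bold>0" using dec'[OF _ scaleT[OF t0(1)]] t by blast
    then show ?thesis using hk t0C by auto
  qed
  have subA: "subgroup T A"
  proof (rule add.subgroupI)
    show "a \<^bold>+ b \<in> T" if ab: "a \<in> T" "b \<in> T" for a b
    proof -
      obtain k l where "a = k \<^bold>\<cdot> t0" "b = l \<^bold>\<cdot> t0" using Tcyc ab by meson
      then have "a \<^bold>+ b = (k + l) \<^bold>\<cdot> t0" using t0C by (simp add: add.int_pow_mult)
      then show ?thesis using scaleT t0 by simp
    qed
    show "\<^bold>- a \<in> T" if "a \<in> T" for a
      using scaleT[OF that, of "- 1"] TC[OF that] by (simp add: add.int_pow_neg)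
  qed (use TC \<open>\<^bold>0 \<in> T\<close> in auto)
  have lamT: "lam b t \<in> T" if "b \<in> C" "t \<in> T" for b t
  proof -
    have "int r \<^bold>\<cdot> lam b t = lam b (int r \<^bold>\<cdot> t)" using that TC by (simp add: lam_scale)
    also have "\<dots> = \<^bold>0" using TK(2)[OF that(2)] that(1) by simp
    finally show ?thesis using Ki(7)[OF that(1) TK(1)[OF that(2)]] by (simp add: T_def)
  qed
  have subM: "subgroup T M"
    using TC by (intro left_ideal_subgroup_M subA lamT) auto
  \<comment> \<open>The power lies in \<open>H\<close>, as the factor has exponent \<open>r\<close>
    in \<open>M\<close>, and in \<open>T\<close>, a subgroup of \<open>M\<close>; these meet in
    0.\<close>
  have powT: "t [^]\<^bsub>M\<^esub> r = \<^bold>0" if "t \<in> T" for t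
  proof -
    have "t [^]\<^bsub>M\<^esub> n \<in> T" for n :: nat
      using that subM \<open>\<^bold>0 \<in> T\<close> by (induction n) (auto simp: subgroup.m_closed)
    then show ?thesis using HT F(6) TK(1) that by blast
  qed
  show id: "ideal T"
  proof (rule idealI[OF subA lamT])
    fix b t assume b: "b \<in> C" and t: "t \<in> T"
    have "int r \<^bold>\<cdot> (b \<^bold>+ t \<^bold>+ \<^bold>- b) = b \<^bold>+ int r \<^bold>\<cdot> t \<^bold>+ \<^bold>- b"
    proof -
      have "(\<lambda>x. b \<^bold>+ x \<^bold>+ \<^bold>- b) \<in> hom A A"
        using b by (auto simp: hom_def add_simps)
      from hom_int_pow[OF this TC[OF t]] show ?thesis using add.is_group by simp
    qed
    also have "\<dots> = \<^bold>0" using TK(2)[OF t] b by simp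
    finally show "b \<^bold>+ t \<^bold>+ \<^bold>- b \<in> T" using Ki(8)[OF b TK(1)[OF t]] by (simp add: T_def)
    \<comment> \<open>The conjugate has trivial r-th power. It factors as \<open>s\<close> times
      \<open>h'\<close> with \<open>s\<close> in \<open>T\<close> and \<open>h'\<close> in
      \<open>H\<close> commuting, so the r-th power of \<open>h'\<close> is trivial as well and
      \<open>h'\<close> vanishes.\<close>
    define t' where "t' = b \<^bold>* t \<^bold>* inv\<^bsub>M\<^esub> b"
    have t'K: "t' \<in> K" using b t TK Ki(10) by (simp add: t'_def)
    have t'C: "t' \<in> C" using b t TC by (simp add: t'_def)
    have "t' [^]\<^bsub>M\<^esub> n = b \<^bold>* t [^]\<^bsub>M\<^esub> n \<^bold>* inv\<^bsub>M\<^esub> b" for n :: nat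
    proof -
      have "(\<lambda>x. b \<^bold>* x \<^bold>* inv\<^bsub>M\<^esub> b) \<in> hom M M"
        using b mult.m_assoc mult.inv_cancel_left by (auto simp: hom_def)
      from hom_nat_pow[OF this, of t n] show ?thesis
        using mult.is_group TC[OF t] by (simp add: t'_def)
    qed
    then have t'r: "t' [^]\<^bsub>M\<^esub> r = \<^bold>0" using powT[OF t] b mult.r_inv by simp
    obtain h k where hk: "h \<in> H" "t' = h \<^bold>+ k \<^bold>\<cdot> t0" using dec t'K by blast
    define s where "s = k \<^bold>\<cdot> t0"
    have s: "s \<in> T" using scaleT t0 by (simp add: s_def)
    define h' where "h' = lam (inv\<^bsub>M\<^esub> s) h"
    have h': "h' \<in> H" using hk(1) TC[OF s] Hi(7) by (simp add: h'_def)
    have "t' = s \<^bold>+ h" using hk comm(1)[OF s hk(1)] by (simp add: s_def)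
    also have "\<dots> = s \<^bold>* h'" using TC[OF s] Hi(14)[OF hk(1)] by (simp add: times_eq h'_def)
    finally have t'eq: "t' = s \<^bold>* h'" .
    have "t' [^]\<^bsub>M\<^esub> r = s [^]\<^bsub>M\<^esub> r \<^bold>* h' [^]\<^bsub>M\<^esub> r"
      unfolding t'eq using TC[OF s] Hi(14)[OF h'] comm(2)[OF s h' powT[OF s]] by (intro mult.pow_mult_distrib) auto
    then have "h' [^]\<^bsub>M\<^esub> r = \<^bold>0" using t'r powT[OF s] Hi(14)[OF h'] by simp
    then have "h' = \<^bold>0" using tf(2) h' by blast
    then show "b \<^bold>* t \<^bold>* inv\<^bsub>M\<^esub> b \<in> T" using s TC[OF s] t'eq by (simp add: t'_def)
  qed
  show "prime_factor r A M {\<^bold>0} T"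
    unfolding prime_factor_def
  proof (intro conjI ballI ideal_zero id)
    show "{\<^bold>0} \<noteq> T" using ne by simp
    fix z w assume z: "z \<in> T - {\<^bold>0}" and w: "w \<in> T"
    then have "z \<notin> H" using HT by blast
    then obtain k where k: "w \<^bold>+ \<^bold>- (k \<^bold>\<cdot> z) \<in> H" using F(7) z w TK(1) by blast
    have "w \<^bold>+ \<^bold>- (k \<^bold>\<cdot> z) \<in> T" using z w scaleT subA by (simp add: subgroup.m_closed subgroup.m_inv_closed)
    then show "\<exists>k. w \<^bold>+ \<^bold>- (k \<^bold>\<cdot> z) \<in> {\<^bold>0}" using k HT by blast
  qed (use \<open>\<^bold>0 \<in> T\<close> powT TK in auto)
  show "\<exists>t\<in>T. w \<^bold>+ \<^bold>- t \<in> H" if w: "w \<in> K" for w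
  proof -
    obtain h k where "h \<in> H" "w = h \<^bold>+ k \<^bold>\<cdot> t0" using dec[OF w] by blast
    then have "w \<^bold>+ \<^bold>- (k \<^bold>\<cdot> t0) \<in> H" using Hi(14) t0C by (simp add: add_simps)
    then show ?thesis using scaleT t0(1) by blast
  qed
qed

lemma conj_hom: "b \<in> C \<Longrightarrow> (\<lambda>x. b \<^bold>+ x \<^bold>+ \<^bold>- b) \<in> hom A A"
  by (auto simp: hom_def add_simps)

lemma small_factor_zeroD:
  assumes "small_factor p A M {\<^bold>0} F"
  shows "finite F" "card F \<le> p"
proof -
  have F: "ideal F" using assms factor_ideals(2) by blast
  obtain S where S: "S \<subseteq> C" "finite S" "card S \<le> p" "\<And>z. z \<in> F \<Longrightarrow> \<exists>s\<in>S. z \<^bold>+ \<^bold>- s \<in> {\<^bold>0}"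
    using assms unfolding small_factor_def by blast
  have "F \<subseteq> S"
  proof
    fix z assume z: "z \<in> F"
    then obtain s where s: "s \<in> S" "z \<^bold>+ \<^bold>- s = \<^bold>0" using S(4) by blast
    then have "z = s" using eq_of_diff[of z s] idealD(14)[OF F z] S(1) by auto
    with s show "z \<in> S" by simp
  qed
  then show "finite F" "card F \<le> p"
    using S(2,3) by (auto intro: finite_subset dest: card_mono[of S F])
qed

text \<open>A permutation of prime order \<open>r\<close> of a set with fewer than \<open>r\<close> elements is trivial, so
  elements of order \<open>r\<close> centralise \<open>F\<close> in both groups.\<close>

lemma swap_small_prime_zero:
  assumes F: "small_factor p A M {\<^bold>0} F" and FK: "prime_factor r A M F K"
    and r: "Factorial_Ring.prime r" "p < r"
  shows "\<exists>T. prime_factor r A M {\<^bold>0} T \<and> small_factor p A M T K"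
proof -
  note P = prime_factorD[OF FK]
  note Fi = idealD[OF P(1)] and Ki = idealD[OF P(2)]
  note small = small_factor_zeroD[OF F]
  then have finF: "finite F" and cardF: "card F < r" using r(2) by auto
  \<comment> \<open>\<open>n\<close> kills \<open>F\<close> in both groups and is prime to
    \<open>r\<close> because \<open>card F < r\<close>; hence \<open>F\<close> has no r-torsion of
    either kind.\<close>
  define n where "n = (fact (card F) :: nat)"
  have kill: "int n \<^bold>\<cdot> f = \<^bold>0" "f [^]\<^bsub>M\<^esub> n = \<^bold>0" if f: "f \<in> F" for f
  proof -
    have fC: "f \<in> C" using f Fi(14) by blast
    have "((\<lambda>x. f \<^bold>+ x) ^^ n) \<^bold>0 = \<^bold>0"
      unfolding n_def using f Fi finF by (intro funpow_fact) (auto intro!: inj_onI)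
    then show "int n \<^bold>\<cdot> f = \<^bold>0" using add.mult_funpow[OF fC, of n] by (simp add: int_pow_int)
    have "((\<lambda>x. f \<^bold>* x) ^^ n) \<^bold>0 = \<^bold>0"
      unfolding n_def
    proof (intro funpow_fact)
      show "inj_on (\<lambda>x. f \<^bold>* x) F"
        using fC Fi(14) mult.l_cancel[of f] by (auto intro!: inj_onI)
    qed (use f Fi finF in auto)
    then show "f [^]\<^bsub>M\<^esub> n = \<^bold>0" using mult.mult_funpow[of f n] fC by simp
  qed
  have "\<not> r dvd n" using r(1) cardF by (simp add: n_def prime_dvd_fact_iff)
  then have cop: "coprime n r" using r(1) by (metis coprime_commute prime_imp_coprime)
  have tf1: "h = \<^bold>0" if "h \<in> F" "int r \<^bold>\<cdot> h = \<^bold>0" for h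
    using add.coprime_pow_mem[of "{\<^bold>0}" h "int n" "int r"] that kill(1)[OF that(1)] cop Fi(14)
      add.triv_subgroup by simp
  have tf2: "h = \<^bold>0" if "h \<in> F" "h [^]\<^bsub>M\<^esub> r = \<^bold>0" for h
    using mult.coprime_pow_mem[of "{\<^bold>0}" h "int n" "int r"] that kill(2)[OF that(1)] cop Fi(14)
      mult.triv_subgroup by (simp add: int_pow_int)
  define T where "T = {t \<in> K. int r \<^bold>\<cdot> t = \<^bold>0}"
  have TC: "t \<in> C" if "t \<in> T" for t using that Ki(14) by (auto simp: T_def)
  have comm1: "t \<^bold>+ h = h \<^bold>+ t" if t: "t \<in> T" and h: "h \<in> F" for t h
  proof -
    have c: "t \<in> C" "h \<in> C" using t h TC Fi(14) by auto
    have "t \<^bold>+ h \<^bold>+ \<^bold>- t = h"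
    proof (rule funpow_prime_fixed[OF finF _ _ h r(1) cardF])
      show "inj_on (\<lambda>b. t \<^bold>+ b \<^bold>+ \<^bold>- t) F" using inj_on_subset[OF add.conj_inj[OF c(1)]] Fi(5) by blast
      show "(\<lambda>b. t \<^bold>+ b \<^bold>+ \<^bold>- t) ` F \<subseteq> F" using c(1) Fi(8) by auto
      show "((\<lambda>b. t \<^bold>+ b \<^bold>+ \<^bold>- t) ^^ r) h = h"
        using t c by (simp add: add.conj_funpow T_def int_pow_int)
    qed
    then show ?thesis using c by (metis add.inv_solve_right' add.m_closed)
  qed
  \<comment> \<open>The n-fold multiple of any \<open>z0\<close> outside \<open>F\<close> is
    r-torsion, since r \<open>z0\<close> lies in \<open>F\<close>. It is nonzero, for otherwise
    coprimality of \<open>n\<close> and \<open>r\<close> would put \<open>z0\<close> into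
    \<open>F\<close>.\<close>
  have ne: "T \<noteq> {\<^bold>0}"
  proof -
    obtain z0 where z0: "z0 \<in> K" "z0 \<notin> F" using P(3,4) by blast
    have z0C: "z0 \<in> C" using z0 Ki(14) by blast
    have "int r \<^bold>\<cdot> (int n \<^bold>\<cdot> z0) = int n \<^bold>\<cdot> (int r \<^bold>\<cdot> z0)"
      using z0C by (simp add: add.int_pow_pow mult.commute)
    also have "\<dots> = \<^bold>0" using kill(1) P(5)[OF z0(1)] by simp
    finally have "int n \<^bold>\<cdot> z0 \<in> T" using Ki(13) z0 by (simp add: T_def)
    moreover have "int n \<^bold>\<cdot> z0 \<noteq> \<^bold>0"
      using add.coprime_pow_mem[OF Fi(1) z0C, of "int n" "int r"] P(5)[OF z0(1)] cop Fi(6) z0(2) by auto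
    ultimately show ?thesis by blast
  qed
  have comm2: "t \<^bold>* h = h \<^bold>* t" if t: "t \<in> T" and tr: "t [^]\<^bsub>M\<^esub> r = \<^bold>0" and h: "h \<in> F" for t h
  proof -
    have c: "t \<in> C" "h \<in> C" using t h TC Fi(14) by auto
    have "t \<^bold>* h \<^bold>* inv\<^bsub>M\<^esub> t = h"
    proof (rule funpow_prime_fixed[OF finF _ _ h r(1) cardF])
      show "inj_on (\<lambda>b. t \<^bold>* b \<^bold>* inv\<^bsub>M\<^esub> t) F"
        using inj_on_subset[OF mult.conj_inj] c(1) Fi(5) by simp
      show "(\<lambda>b. t \<^bold>* b \<^bold>* inv\<^bsub>M\<^esub> t) ` F \<subseteq> F" using c(1) Fi(10) by auto
      show "((\<lambda>b. t \<^bold>* b \<^bold>* inv\<^bsub>M\<^esub> t) ^^ r) h = h"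
        using tr c mult.conj_funpow[of t h r] mult.inv_one by simp
    qed
    then show ?thesis using c mult.inv_solve_right'[of h "t \<^bold>* h" t] by simp
  qed
  have "\<forall>h\<in>F. int r \<^bold>\<cdot> h = \<^bold>0 \<longrightarrow> h = \<^bold>0" "\<forall>h\<in>F. h [^]\<^bsub>M\<^esub> r = \<^bold>0 \<longrightarrow> h = \<^bold>0"
    "\<forall>t\<in>T. \<forall>h\<in>F. t \<^bold>+ h = h \<^bold>+ t" "\<forall>t\<in>T. \<forall>h\<in>F. t [^]\<^bsub>M\<^esub> r = \<^bold>0 \<longrightarrow> t \<^bold>* h = h \<^bold>* t"
    using tf1 tf2 comm1 comm2 by blast+
  note tor = torsion_ideal[OF FK T_def this ne]
  have "small_factor p A M T K"
    unfolding small_factor_def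
  proof (intro conjI exI[of _ F] ballI)
    show "card F \<le> p" using small(2) .
    \<comment> \<open>\<open>F\<close> itself represents the cosets of \<open>T\<close>: if z - t is
      in \<open>F\<close> with t in \<open>T\<close>, then subtracting it from z leaves a conjugate
      of t.\<close>
    fix z assume z: "z \<in> K"
    then obtain t where t: "t \<in> T" "z \<^bold>+ \<^bold>- t \<in> F" using tor by blast
    have c: "t \<in> C" "z \<in> C" using t z TC Ki(14) by auto
    have "z \<^bold>+ \<^bold>- (z \<^bold>+ \<^bold>- t) = z \<^bold>+ t \<^bold>+ \<^bold>- z" using c by (simp add: add_simps)
    then show "\<exists>s\<in>F. z \<^bold>+ \<^bold>- s \<in> T" using t tor idealD(8) c by metis
  qed (use tor P finF Fi in \<open>auto simp: T_def\<close>)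
  then show ?thesis using tor by blast
qed

lemma brace_epi_Mod:
  assumes "ideal N"
  shows "brace_epi A M (A Mod N) (M Mod N) (\<lambda>x. N #>\<^bsub>A\<^esub> x) N"
proof -
  interpret NA: normal N A using idealD(3)[OF assms] .
  interpret NM: normal N M using idealD(4)[OF assms] .
  let ?q = "\<lambda>x. N #>\<^bsub>A\<^esub> x"
  have carr: "carrier (A Mod N) = ?q ` C" "carrier (M Mod N) = ?q ` C"
    by (auto simp: FactGroup_def RCOSETS_def coset_eq[OF assms])
  have plus: "?q x \<otimes>\<^bsub>A Mod N\<^esub> ?q y = ?q (x \<^bold>+ y)" if "x \<in> C" "y \<in> C" for x y
    using NA.rcos_sum that by (simp add: FactGroup_def)
  have times: "?q x \<otimes>\<^bsub>M Mod N\<^esub> ?q y = ?q (x \<^bold>* y)" if "x \<in> C" "y \<in> C" for x y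
    using NM.rcos_sum[of x y] that by (simp add: FactGroup_def coset_eq[OF assms])
  have neg: "inv\<^bsub>A Mod N\<^esub> ?q x = ?q (\<^bold>- x)" if "x \<in> C" for x
    using NA.inv_FactGroup[of "?q x"] NA.rcos_inv[of x] that by (simp add: carr)
  have "brace (A Mod N) (M Mod N)"
    unfolding brace_def using NA.factorgroup_is_group NM.factorgroup_is_group
    by (auto simp: carr plus times neg brace_distrib simp del: mult_FactGroup)
  moreover have "(?q x = \<one>\<^bsub>A Mod N\<^esub>) = (x \<in> N)" if "x \<in> C" for x
    using that NA.rcos_const[of x] add.rcos_self[OF that NA.subgroup_axioms] by auto
  ultimately show ?thesis
    using assms skew_brace_axioms
    by (auto simp: brace_epi_def brace_epi_axioms_def skew_brace_def hom_def carr plus times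
        simp del: mult_FactGroup one_FactGroup)
qed

subsection \<open>Infinite cyclic factors\<close>

lemma scale_cong:
  assumes "ideal K" "x \<in> C" "y \<in> C" "x \<^bold>+ \<^bold>- y \<in> K"
  shows "k \<^bold>\<cdot> x \<^bold>+ \<^bold>- (k \<^bold>\<cdot> y) \<in> K"
proof -
  interpret q: brace_epi A M "A Mod K" "M Mod K" "\<lambda>x. K #>\<^bsub>A\<^esub> x" K
    using brace_epi_Mod[OF assms(1)] .
  have "K #>\<^bsub>A\<^esub> x = K #>\<^bsub>A\<^esub> y" using q.proj_eq_iff assms by blast
  then have "K #>\<^bsub>A\<^esub> (k \<^bold>\<cdot> x) = K #>\<^bsub>A\<^esub> (k \<^bold>\<cdot> y)"
    using q.proj_simps(4)[of x k] q.proj_simps(4)[of y k] assms by simp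
  then show ?thesis using q.proj_eq_iff assms by simp
qed

lemma add_cong:
  assumes "ideal K" "x \<in> C" "y \<in> C" "x' \<in> C" "y' \<in> C" "x \<^bold>+ \<^bold>- y \<in> K" "x' \<^bold>+ \<^bold>- y' \<in> K"
  shows "(x \<^bold>+ x') \<^bold>+ \<^bold>- (y \<^bold>+ y') \<in> K"
proof -
  have "(x \<^bold>+ x') \<^bold>+ \<^bold>- (y \<^bold>+ y') = (x \<^bold>+ (x' \<^bold>+ \<^bold>- y') \<^bold>+ \<^bold>- x) \<^bold>+ (x \<^bold>+ \<^bold>- y)"
    using assms by (simp add: add_simps)
  also have "\<dots> \<in> K"
    using idealD(11)[OF assms(1) idealD(8)[OF assms(1,2,7)] assms(6)] .
  finally show ?thesis .
qed

lemma diff_mem_trans: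
  assumes "ideal K" "x \<in> C" "y \<in> C" "z \<in> C" "x \<^bold>+ \<^bold>- y \<in> K" "y \<^bold>+ \<^bold>- z \<in> K"
  shows "x \<^bold>+ \<^bold>- z \<in> K"
proof -
  have "x \<^bold>+ \<^bold>- z = (x \<^bold>+ \<^bold>- y) \<^bold>+ (y \<^bold>+ \<^bold>- z)" using assms by (simp add: add_simps)
  then show ?thesis using assms idealD(11) by simp
qed

text \<open>This is K + Z(dy). If \<open>L / K\<close> is infinite cyclic with generator
  \<open>y\<close> and d > 0, it is the ideal of index d in \<open>L\<close> that contains
  \<open>K\<close>.\<close>

definition multiples :: "'a set \<Rightarrow> 'a \<Rightarrow> nat \<Rightarrow> 'a set" where
  "multiples K y d = {z \<in> C. \<exists>k. z \<^bold>+ \<^bold>- ((int d * k) \<^bold>\<cdot> y) \<in> K}"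

text \<open>An infinite factor together with a chosen generator, which \<open>multiples\<close> has
  to refer to.\<close>

definition cyclic_mod :: "'a set \<Rightarrow> 'a set \<Rightarrow> 'a \<Rightarrow> bool" where
  "cyclic_mod K L y \<longleftrightarrow> infinite_factor A M K L \<and> y \<in> L \<and>
     (\<forall>z\<in>L. \<exists>k. z \<^bold>+ \<^bold>- (k \<^bold>\<cdot> y) \<in> K) \<and> (\<forall>k. k \<^bold>\<cdot> y \<in> K \<longrightarrow> k = 0)"

lemma infinite_factor_cyclic: "infinite_factor A M K L \<longleftrightarrow> (\<exists>y. cyclic_mod K L y)"
  unfolding cyclic_mod_def infinite_factor_def by blast

lemma cyclic_modD:
  assumes "cyclic_mod K L y"
  shows "ideal K" "ideal L" "K \<subseteq> L" "y \<in> L" "y \<in> C"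
    and "\<And>z. z \<in> L \<Longrightarrow> \<exists>k. z \<^bold>+ \<^bold>- (k \<^bold>\<cdot> y) \<in> K"
    and "\<And>k. k \<^bold>\<cdot> y \<in> K \<Longrightarrow> k = 0"
    and "\<And>z b. z \<in> L \<Longrightarrow> b \<in> C \<Longrightarrow> lam z b \<^bold>+ \<^bold>- b \<in> K"
    and "\<And>z b. z \<in> L \<Longrightarrow> b \<in> C \<Longrightarrow> z \<^bold>+ b \<^bold>+ \<^bold>- z \<^bold>+ \<^bold>- b \<in> K"
proof -
  have 1: "infinite_factor A M K L" and 2: "y \<in> L" "\<And>z. z \<in> L \<Longrightarrow> \<exists>k. z \<^bold>+ \<^bold>- (k \<^bold>\<cdot> y) \<in> K" "\<And>k. k \<^bold>\<cdot> y \<in> K \<Longrightarrow> k = 0"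
    using assms unfolding cyclic_mod_def by blast+
  show "ideal K" "ideal L" "K \<subseteq> L" "\<And>z b. z \<in> L \<Longrightarrow> b \<in> C \<Longrightarrow> lam z b \<^bold>+ \<^bold>- b \<in> K"
    "\<And>z b. z \<in> L \<Longrightarrow> b \<in> C \<Longrightarrow> z \<^bold>+ b \<^bold>+ \<^bold>- z \<^bold>+ \<^bold>- b \<in> K"
    using 1 unfolding infinite_factor_def by blast+
  then show "y \<in> C" using 2(1) idealD(14) by blast
qed (use assms in \<open>unfold cyclic_mod_def, blast+\<close>)

lemma cyclic_zeroD:
  assumes "cyclic_mod {\<^bold>0} U u"
  shows "\<And>z. z \<in> U \<Longrightarrow> \<exists>k. z = k \<^bold>\<cdot> u"
    and "\<And>k. k \<^bold>\<cdot> u = \<^bold>0 \<Longrightarrow> k = 0"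
    and "\<And>z b. z \<in> U \<Longrightarrow> b \<in> C \<Longrightarrow> lam z b = b"
    and "\<And>z b. z \<in> U \<Longrightarrow> b \<in> C \<Longrightarrow> z \<^bold>+ b = b \<^bold>+ z"
proof -
  note D = cyclic_modD[OF assms]
  note UC = idealD(14)[OF D(2)]
  show "\<exists>k. z = k \<^bold>\<cdot> u" if "z \<in> U" for z using D(6)[OF that] eq_of_diff UC[OF that] D(5) by blast
  show "k = 0" if "k \<^bold>\<cdot> u = \<^bold>0" for k using D(7) that by simp
  show "lam z b = b" if "z \<in> U" "b \<in> C" for z b
    using D(8)[OF that] eq_of_diff[of "lam z b" b] UC that by simp
  show "z \<^bold>+ b = b \<^bold>+ z" if "z \<in> U" "b \<in> C" for z b
  proof (rule eq_of_diff)
    have "(z \<^bold>+ b) \<^bold>+ \<^bold>- (b \<^bold>+ z) = z \<^bold>+ b \<^bold>+ \<^bold>- z \<^bold>+ \<^bold>- b" using that UC by (simp add: add_simps)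
    then show "(z \<^bold>+ b) \<^bold>+ \<^bold>- (b \<^bold>+ z) = \<^bold>0" using D(9)[OF that] by simp
  qed (use that UC in auto)
qed

lemma pow_M_lam_trivial:
  assumes v: "v \<in> C" and soc: "\<And>b. b \<in> C \<Longrightarrow> lam v b = b"
  shows "v [^]\<^bsub>M\<^esub> n = int n \<^bold>\<cdot> v"
proof (induction n)
  case (Suc n)
    have "v [^]\<^bsub>M\<^esub> Suc n = v \<^bold>* v [^]\<^bsub>M\<^esub> n" using v mult.nat_pow_Suc2 by simp
    also have "\<dots> = v \<^bold>+ v [^]\<^bsub>M\<^esub> n" using v soc by (simp add: times_eq)
    also have "\<dots> = int (Suc n) \<^bold>\<cdot> v" using v Suc by (simp add: add.int_pow_mult)
    finally show ?case .
qed simp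

lemma lam_trivial_scale:
  assumes v: "v \<in> C" and soc: "\<And>b. b \<in> C \<Longrightarrow> lam v b = b" and b: "b \<in> C"
  shows "lam (k \<^bold>\<cdot> v) b = b"
proof -
  have pow: "v [^]\<^bsub>M\<^esub> n = int n \<^bold>\<cdot> v" for n :: nat
    using soc by (rule pow_M_lam_trivial[OF v])
  have lamn: "lam (int n \<^bold>\<cdot> v) b = b" if "b \<in> C" for n b
    unfolding pow[symmetric] lam_pow[OF v that] using soc[OF that] by (induction n) auto
  show "lam (k \<^bold>\<cdot> v) b = b"
  proof (cases "0 \<le> k")
    case True
    then show ?thesis using lamn[OF b, of "nat k"] by simp
  next
    case False
    then obtain n where n: "k = - int n" by (metis neg_int_cases not_le)
    \<comment> \<open>Since the n-fold multiple of \<open>v\<close> acts trivially, its product with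
      the negative multiple is their sum 0. The two actions are therefore mutually inverse.\<close>
    have "int n \<^bold>\<cdot> v \<^bold>* k \<^bold>\<cdot> v = \<^bold>0"
      using v n lamn by (simp add: times_eq flip: add.int_pow_mult)
    then have "lam (int n \<^bold>\<cdot> v) (lam (k \<^bold>\<cdot> v) b) = b"
      using v b by (simp flip: lam_times)
    then show ?thesis using lamn v b by simp
  qed
qed

text \<open>Reduces the construction of an infinite cyclic ideal inside the socle to a single
  element: of infinite order, in the socle, and sent to a multiple of itself by every
  \<open>lam\<close>.\<close>

lemma cyclic_zeroI:
  assumes v: "v \<in> C" and inf: "\<And>k. k \<^bold>\<cdot> v = \<^bold>0 \<Longrightarrow> k = 0"
    and soc: "\<And>b. b \<in> C \<Longrightarrow> lam v b = b" "\<And>b. b \<in> C \<Longrightarrow> v \<^bold>+ b = b \<^bold>+ v"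
    and inv: "\<And>b. b \<in> C \<Longrightarrow> \<exists>e. lam b v = e \<^bold>\<cdot> v"
  shows "cyclic_mod {\<^bold>0} (range (\<lambda>k. k \<^bold>\<cdot> v)) v"
proof -
  let ?J = "range (\<lambda>k. k \<^bold>\<cdot> v)"
  have central: "k \<^bold>\<cdot> v \<^bold>+ b = b \<^bold>+ k \<^bold>\<cdot> v" if "b \<in> C" for k b
  proof -
    have "b \<^bold>+ k \<^bold>\<cdot> v \<^bold>+ \<^bold>- b = k \<^bold>\<cdot> (b \<^bold>+ v \<^bold>+ \<^bold>- b)"
      using hom_int_pow[OF conj_hom[OF that] v add.is_group add.is_group] .
    also have "\<dots> = k \<^bold>\<cdot> v" using soc(2)[OF that, symmetric] that v by (simp add: add_simps)
    finally have "b \<^bold>+ k \<^bold>\<cdot> v \<^bold>+ \<^bold>- b \<^bold>+ b = k \<^bold>\<cdot> v \<^bold>+ b" by simp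
    then show ?thesis using that v by (simp add: add_simps)
  qed
  have lamk: "lam (k \<^bold>\<cdot> v) b = b" if "b \<in> C" for k b
    using soc(1) that by (intro lam_trivial_scale[OF v]) auto
  have sub: "subgroup ?J A"
  proof (rule add.subgroupI)
    fix a b assume "a \<in> ?J" "b \<in> ?J"
    then obtain k l where "a = k \<^bold>\<cdot> v" "b = l \<^bold>\<cdot> v" by blast
    then have "a \<^bold>+ b = (k + l) \<^bold>\<cdot> v" "\<^bold>- a = (- k) \<^bold>\<cdot> v" using v by (simp_all add: add.int_pow_mult add.int_pow_neg)
    then show "a \<^bold>+ b \<in> ?J" "\<^bold>- a \<in> ?J" by blast+
  qed (use v in auto)
  have lamJ: "lam b x \<in> ?J" if "b \<in> C" "x \<in> ?J" for b x
  proof -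
    obtain k where "x = k \<^bold>\<cdot> v" using \<open>x \<in> ?J\<close> by blast
    moreover obtain e where "lam b v = e \<^bold>\<cdot> v" using inv \<open>b \<in> C\<close> by blast
    ultimately have "lam b x = (e * k) \<^bold>\<cdot> v" using that v by (simp add: lam_scale add.int_pow_pow)
    then show ?thesis by blast
  qed
  have idJ: "ideal ?J"
  proof (rule idealI[OF sub lamJ])
    fix b x assume b: "b \<in> C" and x: "x \<in> ?J"
    have xC: "x \<in> C" using x v by auto
    have "b \<^bold>+ x \<^bold>+ \<^bold>- b = x" using x b central v by (auto simp: add_simps simp flip: central)
    then show "b \<^bold>+ x \<^bold>+ \<^bold>- b \<in> ?J" using x by simp
    \<comment> \<open>\<open>t\<close> is the conjugate of \<open>x\<close> by \<open>b\<close> in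
      \<open>M\<close>: bx = b + t = t + b = tb, as \<open>t\<close> is central and acts
      trivially.\<close>
    define t where "t = lam b x"
    obtain k where k: "t = k \<^bold>\<cdot> v" using lamJ b x t_def by blast
    have "b \<^bold>* x = b \<^bold>+ t" using b xC by (simp add: times_eq t_def)
    also have "\<dots> = t \<^bold>* b" using k central lamk b v by (simp add: times_eq)
    finally have "b \<^bold>* x \<^bold>* inv\<^bsub>M\<^esub> b = t" using b xC k v mult.inv_solve_right' by simp
    then show "b \<^bold>* x \<^bold>* inv\<^bsub>M\<^esub> b \<in> ?J" using k by simp
  qed
  have comm: "k \<^bold>\<cdot> v \<^bold>+ b \<^bold>+ \<^bold>- (k \<^bold>\<cdot> v) \<^bold>+ \<^bold>- b = \<^bold>0" if "b \<in> C" for b k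
    using central[OF that, of k] that v by (simp add: add_simps)
  have vJ: "v \<in> ?J" using v add.int_pow_1 by (metis rangeI)
  have zJ: "\<^bold>0 \<in> ?J" using sub subgroup.one_closed by blast
  have gen: "\<exists>k. z \<^bold>+ \<^bold>- (k \<^bold>\<cdot> v) \<in> {\<^bold>0}" if z: "z \<in> ?J" for z
  proof -
    obtain k where "z = k \<^bold>\<cdot> v" using z by blast
    then show ?thesis using v by (intro exI[of _ k]) simp
  qed
  have inf': "\<forall>k. k \<^bold>\<cdot> v \<in> {\<^bold>0} \<longrightarrow> k = 0" using inf by blast
  have socJ: "\<forall>z\<in>?J. \<forall>b\<in>C. lam z b \<^bold>+ \<^bold>- b \<in> {\<^bold>0} \<and> z \<^bold>+ b \<^bold>+ \<^bold>- z \<^bold>+ \<^bold>- b \<in> {\<^bold>0}"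
    using lamk comm by auto
  have "infinite_factor A M {\<^bold>0} ?J"
    unfolding infinite_factor_def
    using ideal_zero idJ zJ vJ gen inf' socJ by blast
  then show ?thesis unfolding cyclic_mod_def using vJ gen inf' by blast
qed

lemma cyclic_lam:
  assumes "cyclic_mod {\<^bold>0} U u" "b \<in> C"
  shows "\<exists>e. lam b u = e \<^bold>\<cdot> u"
  using cyclic_zeroD(1)[OF assms(1)] idealD(7)[OF cyclic_modD(2)[OF assms(1)] assms(2)]
    cyclic_modD(4)[OF assms(1)] by blast

lemma multiples_zero:
  assumes U: "cyclic_mod {\<^bold>0} U u" and d: "d > 0"
  shows "cyclic_mod {\<^bold>0} (multiples {\<^bold>0} u d) (int d \<^bold>\<cdot> u)"
proof -
  note D = cyclic_modD[OF U] and Z = cyclic_zeroD[OF U]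
  have du: "int d \<^bold>\<cdot> u \<in> U" using idealD(13)[OF D(2,4)] .
  have "z \<^bold>+ \<^bold>- (k \<^bold>\<cdot> u) = \<^bold>0 \<longleftrightarrow> z = k \<^bold>\<cdot> u" if "z \<in> C" for z k
    using that D(5) eq_of_diff[of z "k \<^bold>\<cdot> u"] by auto
  then have "multiples {\<^bold>0} u d = range (\<lambda>k. k \<^bold>\<cdot> (int d \<^bold>\<cdot> u))"
    using D(5) by (auto simp: multiples_def add.int_pow_pow)
  moreover have "cyclic_mod {\<^bold>0} (range (\<lambda>k. k \<^bold>\<cdot> (int d \<^bold>\<cdot> u))) (int d \<^bold>\<cdot> u)"
  proof (rule cyclic_zeroI)
    show "k = 0" if "k \<^bold>\<cdot> (int d \<^bold>\<cdot> u) = \<^bold>0" for k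
      using that d D(5) Z(2)[of "int d * k"] by (simp add: add.int_pow_pow)
    show "\<exists>e. lam b (int d \<^bold>\<cdot> u) = e \<^bold>\<cdot> (int d \<^bold>\<cdot> u)" if b: "b \<in> C" for b
    proof -
      obtain e where "lam b u = e \<^bold>\<cdot> u" using cyclic_lam[OF U b] by blast
      then have "lam b (int d \<^bold>\<cdot> u) = e \<^bold>\<cdot> (int d \<^bold>\<cdot> u)"
        using b D(5) by (simp add: lam_scale add.int_pow_pow mult.commute)
      then show ?thesis by blast
    qed
  qed (use D(5) du Z in auto)
  ultimately show ?thesis by simp
qed

lemma multiples_one: "cyclic_mod K L y \<Longrightarrow> multiples K y 1 = L"
proof -
  assume c: "cyclic_mod K L y"
  note D = cyclic_modD[OF c]
  have "z \<in> L" if "z \<in> C" "z \<^bold>+ \<^bold>- (k \<^bold>\<cdot> y) \<in> K" for z k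
  proof -
    have "z \<^bold>+ \<^bold>- (k \<^bold>\<cdot> y) \<^bold>+ k \<^bold>\<cdot> y \<in> L"
      using that D(3) idealD(11,13)[OF D(2)] D(4) by blast
    then show ?thesis using that D(5) by (simp add: add_simps)
  qed
  then show ?thesis using D(6) idealD(14)[OF D(2)] by (auto simp: multiples_def)
qed

end

context brace_epi
begin

lemma proj_N: "proj ` N = {Q.zero}"
  using ker idealD(6,14)[OF N] by (auto simp: image_iff) (metis ker)+

lemma cyclic_mod_proj:
  assumes "cyclic_mod K L y" "N \<subseteq> K"
  shows "Q.cyclic_mod (proj ` K) (proj ` L) (proj y)"
proof -
  note D = cyclic_modD[OF assms(1)]
  have L: "ideal L" "N \<subseteq> L" and K: "ideal K" "N \<subseteq> K" using D assms(2) by blast+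
  note LC = idealD(14)[OF L(1)]
  have "infinite_factor A' M' (proj ` K) (proj ` L)"
    using assms(1) infinite_factor_proj[OF K L] by (auto simp: cyclic_mod_def)
  moreover have "\<exists>k. Q.plus (proj z) (Q.neg (Q.scale k (proj y))) \<in> proj ` K" if "z \<in> L" for z
    using D(6)[OF that] LC[OF that] D(5) by (simp add: proj_simps proj_mem_iff[OF K])
  moreover have "k = 0" if "Q.scale k (proj y) \<in> proj ` K" for k
    using that D(5,7) by (simp add: proj_simps proj_mem_iff[OF K])
  ultimately show ?thesis unfolding Q.cyclic_mod_def using D(4) by blast
qed

lemma multiples_proj:
  assumes "ideal K" "N \<subseteq> K" "y \<in> C"
  shows "{x \<in> C. proj x \<in> Q.multiples (proj ` K) (proj y) d} = multiples K y d"
proof -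
  have "Q.plus (proj x) (Q.neg (Q.scale k (proj y))) \<in> proj ` K \<longleftrightarrow> x \<^bold>+ \<^bold>- (k \<^bold>\<cdot> y) \<in> K" if "x \<in> C" for x k
    using that assms by (simp add: proj_simps proj_mem_iff)
  then show ?thesis unfolding Q.multiples_def multiples_def using proj_closed by blast
qed

end

context skew_brace
begin

text \<open>In the quotient by \<open>K\<close> the generator lies in the socle, so
  \<open>multiples_zero\<close> applies there and is pulled back.\<close>

lemma multiples_cyclic:
  assumes c: "cyclic_mod K L y" and d: "d > 0"
  shows "cyclic_mod K (multiples K y d) (int d \<^bold>\<cdot> y)"
proof -
  note D = cyclic_modD[OF c]
  define q where "q = (\<lambda>x. K #>\<^bsub>A\<^esub> x)"
  interpret q: brace_epi A M "A Mod K" "M Mod K" q K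
    unfolding q_def by (rule brace_epi_Mod[OF D(1)])
  let ?W = "q.Q.multiples {q.Q.zero} (q y) d"
  have "q.Q.cyclic_mod {q.Q.zero} ?W (q.Q.scale (int d) (q y))"
    using q.Q.multiples_zero q.cyclic_mod_proj[OF c] d by (simp add: q.proj_N)
  then have W: "q.Q.ideal ?W" "infinite_factor (A Mod K) (M Mod K) {q.Q.zero} ?W"
    using q.Q.cyclic_modD(2) unfolding q.Q.cyclic_mod_def by blast+
  note v = q.ideal_vimage[OF W(1)]
  have eq: "{x \<in> C. q x \<in> ?W} = multiples K y d"
    using q.multiples_proj[OF D(1) _ D(5)] by (simp add: q.proj_N)
  have "infinite_factor A M K (multiples K y d)"
    using W(2) q.infinite_factor_proj[OF D(1) _ v(1,2)] v(3) unfolding q.proj_N eq by simp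
  moreover have "\<^bold>0 = int d \<^bold>\<cdot> y \<^bold>+ \<^bold>- ((int d * 1) \<^bold>\<cdot> y)" using D(5) by simp
  then have "int d \<^bold>\<cdot> y \<in> multiples K y d"
    using D(5) idealD(6)[OF D(1)] unfolding multiples_def by (metis (mono_tags, lifting) add.int_pow_closed mem_Collect_eq)
  moreover have "\<exists>k. z \<^bold>+ \<^bold>- (k \<^bold>\<cdot> int d \<^bold>\<cdot> y) \<in> K" if "z \<in> multiples K y d" for z
    using that D(5) unfolding multiples_def by (auto simp: add.int_pow_pow)
  moreover have "k = 0" if "k \<^bold>\<cdot> int d \<^bold>\<cdot> y \<in> K" for k
    using that d D(5) D(7)[of "int d * k"] by (simp add: add.int_pow_pow)
  ultimately show ?thesis unfolding cyclic_mod_def by blast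
qed

lemma multiples_small_factor:
  assumes c: "cyclic_mod K L y" and d: "d > 0" and e: "0 < e" "e \<le> p"
  shows "small_factor p A M (multiples K y (d * e)) (multiples K y d)"
  unfolding small_factor_def
proof (intro conjI exI ballI)
  note D = cyclic_modD[OF c]
  show "ideal (multiples K y (d * e))" "ideal (multiples K y d)"
    using cyclic_modD(2)[OF multiples_cyclic[OF c]] d e by simp_all
  show "multiples K y (d * e) \<subseteq> multiples K y d"
    by (auto simp: multiples_def mult.assoc)
  let ?S = "(\<lambda>i. (int d * int i) \<^bold>\<cdot> y) ` {..<e}"
  show "?S \<subseteq> C" using D(5) by auto
  show "finite ?S" by simp
  show "card ?S \<le> p" using card_image_le[of "{..<e}" "\<lambda>i. (int d * int i) \<^bold>\<cdot> y"] e by simp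
  fix z assume "z \<in> multiples K y d"
  then obtain k where z: "z \<in> C" "z \<^bold>+ \<^bold>- ((int d * k) \<^bold>\<cdot> y) \<in> K" by (auto simp: multiples_def)
  \<comment> \<open>The residue of \<open>k\<close> modulo \<open>e\<close> selects the
    representative; the remaining multiple of de is absorbed by the smaller ideal.\<close>
  define i where "i = nat (k mod int e)"
  have i: "i < e" "int i = k mod int e" using e by (simp_all add: i_def nat_less_iff)
  have k: "int d * k = int (d * e) * (k div int e) + int d * int i"
    unfolding i(2) by (simp flip: distrib_left add: mult.assoc)
  have "(int d * k) \<^bold>\<cdot> y = (int (d * e) * (k div int e)) \<^bold>\<cdot> y \<^bold>+ (int d * int i) \<^bold>\<cdot> y"
    unfolding k using D(5) by (rule add.int_pow_mult)
  then have "z \<^bold>+ \<^bold>- ((int d * int i) \<^bold>\<cdot> y) \<^bold>+ \<^bold>- ((int (d * e) * (k div int e)) \<^bold>\<cdot> y) \<in> K"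
    using z D(5) by (simp add: add_simps)
  then have "z \<^bold>+ \<^bold>- ((int d * int i) \<^bold>\<cdot> y) \<in> multiples K y (d * e)"
    using z(1) D(5) unfolding multiples_def by blast
  then show "\<exists>s\<in>?S. z \<^bold>+ \<^bold>- s \<in> multiples K y (d * e)" using i(1) by blast
qed

text \<open>If \<open>K\<close> has \<open>r\<close>-torsion, the torsion is an ideal that can be moved to the bottom; otherwise
  \<open>K\<close> itself is infinite cyclic.\<close>

lemma swap_infinite_prime_zero:
  assumes U: "infinite_factor A M {\<^bold>0} U" and UK: "prime_factor r A M U K"
    and r: "Factorial_Ring.prime r" "odd r"
  shows "infinite_factor A M {\<^bold>0} K \<or> (\<exists>T. prime_factor r A M {\<^bold>0} T \<and> infinite_factor A M T K)"
proof -
  obtain u where u: "cyclic_mod {\<^bold>0} U u" using U infinite_factor_cyclic by blast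
  note D = cyclic_modD[OF u] and Z = cyclic_zeroD[OF u]
  note P = prime_factorD[OF UK]
  note Ki = idealD[OF P(2)] and Ui = idealD[OF P(1)]
  have rpos: "r > 0" using r(1) prime_gt_0_nat by blast
  \<comment> \<open>\<open>z\<close> acts on \<open>U\<close> as multiplication by some
    \<open>e\<close>. Its r-th power lies in \<open>U\<close> and acts trivially, so
    \<open>e ^ r = 1\<close>, and \<open>r\<close> is odd.\<close>
  have lam_u: "lam z u = u" if z: "z \<in> K" for z
  proof -
    have zC: "z \<in> C" using z Ki(14) by blast
    obtain e where e: "lam z u = e \<^bold>\<cdot> u" using cyclic_lam[OF u zC] by blast
    have "(lam z ^^ n) u = (e ^ n) \<^bold>\<cdot> u" for n
    proof (induction n)
      case (Suc n)
      then show ?case using zC D(5) e by (simp add: lam_scale add.int_pow_pow)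
    qed (use D(5) in simp)
    then have "(e ^ r) \<^bold>\<cdot> u = lam (z [^]\<^bsub>M\<^esub> r) u" using lam_pow[OF zC D(5)] by simp
    also have "\<dots> = u" using P(6)[OF z] Z(3) D(5) by blast
    finally have "(e ^ r - 1) \<^bold>\<cdot> u = \<^bold>0" using D(5) add.int_pow_diff[of u "e ^ r" 1] by simp
    then have er: "e ^ r = 1" using Z(2)[of "e ^ r - 1"] by simp
    then have "e = 1" using odd_power_eq_one r(2) by blast
    then show ?thesis using e D(5) by simp
  qed
  have lam_U: "lam z h = h" if "z \<in> K" "h \<in> U" for z h
  proof -
    obtain k where "h = k \<^bold>\<cdot> u" using Z(1) \<open>h \<in> U\<close> by blast
    then show ?thesis using that lam_u Ki(14) D(5) by (simp add: lam_scale)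
  qed
  have tfU: "h = \<^bold>0" if "h \<in> U" "int r \<^bold>\<cdot> h = \<^bold>0" for h
  proof -
    obtain k where k: "h = k \<^bold>\<cdot> u" using Z(1) \<open>h \<in> U\<close> by blast
    then have "(k * int r) \<^bold>\<cdot> u = \<^bold>0" using that D(5) by (simp add: add.int_pow_pow)
    then have "k = 0" using Z(2) rpos by fastforce
    then show ?thesis using k by simp
  qed
  obtain z0 where z0: "z0 \<in> K" "z0 \<notin> U" using P(3,4) by blast
  have z0C: "z0 \<in> C" using z0 Ki(14) by blast
  have dec: "\<exists>h\<in>U. \<exists>k. w = h \<^bold>+ k \<^bold>\<cdot> z0" if w: "w \<in> K" for w
  proof -
    obtain k where "w \<^bold>+ \<^bold>- (k \<^bold>\<cdot> z0) \<in> U" using P(7)[OF z0 w] by blast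
    moreover have "w = (w \<^bold>+ \<^bold>- (k \<^bold>\<cdot> z0)) \<^bold>+ k \<^bold>\<cdot> z0"
      using Ki(14)[OF w] z0C by (simp add: add_simps)
    ultimately show ?thesis by blast
  qed
  \<comment> \<open>\<open>K\<close> is generated by the central subgroup \<open>U\<close> and one
    further element.\<close>
  have commK: "x \<^bold>+ y = y \<^bold>+ x" if x: "x \<in> K" and y: "y \<in> K" for x y
  proof -
    obtain h k where h: "h \<in> U" "x = h \<^bold>+ k \<^bold>\<cdot> z0" using dec[OF x] by blast
    obtain h' k' where h': "h' \<in> U" "y = h' \<^bold>+ k' \<^bold>\<cdot> z0" using dec[OF y] by blast
    have c: "h \<in> C" "h' \<in> C" using h h' Ui(14) by auto
    have "k \<^bold>\<cdot> z0 \<^bold>+ k' \<^bold>\<cdot> z0 = k' \<^bold>\<cdot> z0 \<^bold>+ k \<^bold>\<cdot> z0"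
      using z0C by (simp flip: add.int_pow_mult add: add.commute)
    moreover have "x \<^bold>+ y = h \<^bold>+ h' \<^bold>+ (k \<^bold>\<cdot> z0 \<^bold>+ k' \<^bold>\<cdot> z0)"
    proof -
      have "x \<^bold>+ y = h \<^bold>+ (k \<^bold>\<cdot> z0 \<^bold>+ h') \<^bold>+ k' \<^bold>\<cdot> z0" using h h' c z0C by (simp add: add_simps)
      also have "k \<^bold>\<cdot> z0 \<^bold>+ h' = h' \<^bold>+ k \<^bold>\<cdot> z0" using Z(4)[OF h'(1)] z0C by simp
      finally show ?thesis using c z0C by (simp add: add_simps)
    qed
    moreover have "y \<^bold>+ x = h' \<^bold>+ h \<^bold>+ (k' \<^bold>\<cdot> z0 \<^bold>+ k \<^bold>\<cdot> z0)"
    proof -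
      have "y \<^bold>+ x = h' \<^bold>+ (k' \<^bold>\<cdot> z0 \<^bold>+ h) \<^bold>+ k \<^bold>\<cdot> z0" using h h' c z0C by (simp add: add_simps)
      also have "k' \<^bold>\<cdot> z0 \<^bold>+ h = h \<^bold>+ k' \<^bold>\<cdot> z0" using Z(4)[OF h(1)] z0C by simp
      finally show ?thesis using c z0C by (simp add: add_simps)
    qed
    ultimately show ?thesis using Z(4)[OF h(1) c(2)] by simp
  qed
  define T where "T = {t \<in> K. int r \<^bold>\<cdot> t = \<^bold>0}"
  show ?thesis
  proof (cases "T = {\<^bold>0}")
    case False
    have "\<forall>h\<in>U. int r \<^bold>\<cdot> h = \<^bold>0 \<longrightarrow> h = \<^bold>0" using tfU by blast
    moreover have "\<forall>h\<in>U. h [^]\<^bsub>M\<^esub> r = \<^bold>0 \<longrightarrow> h = \<^bold>0"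
    proof (intro ballI impI)
      fix h assume h: "h \<in> U" and hr: "h [^]\<^bsub>M\<^esub> r = \<^bold>0"
      have "h [^]\<^bsub>M\<^esub> r = int r \<^bold>\<cdot> h"
        using Ui(14)[OF h] Z(3)[OF h] by (intro pow_M_lam_trivial) auto
      then show "h = \<^bold>0" using tfU[OF h] hr by simp
    qed
    moreover have "\<forall>t\<in>T. \<forall>h\<in>U. t \<^bold>+ h = h \<^bold>+ t" using Z(4) Ki(14) by (simp add: T_def)
    moreover have "\<forall>t\<in>T. \<forall>h\<in>U. t [^]\<^bsub>M\<^esub> r = \<^bold>0 \<longrightarrow> t \<^bold>* h = h \<^bold>* t"
    proof (intro ballI impI)
      fix t h assume "t \<in> T" and h: "h \<in> U"
      then have t: "t \<in> K" by (simp add: T_def)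
      show "t \<^bold>* h = h \<^bold>* t"
        using Ki(14)[OF t] Ui(14)[OF h] lam_U[OF t h] Z(3,4)[OF h, of t] by (simp add: times_eq)
    qed
    ultimately have tor: "ideal T" "prime_factor r A M {\<^bold>0} T" "\<And>w. w \<in> K \<Longrightarrow> \<exists>t\<in>T. w \<^bold>+ \<^bold>- t \<in> U"
      using torsion_ideal[OF UK T_def _ _ _ _ False] by blast+
    have TK: "T \<subseteq> K" by (auto simp: T_def)
    have split: "\<exists>h\<in>U. \<exists>t\<in>T. w = h \<^bold>+ t" if w: "w \<in> K" for w
    proof -
      obtain t where t: "t \<in> T" "w \<^bold>+ \<^bold>- t \<in> U" using tor(3)[OF w] by blast
      have "w = (w \<^bold>+ \<^bold>- t) \<^bold>+ t" using t(1) idealD(14)[OF tor(1)] Ki(14)[OF w] by (simp add: add_simps)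
      then show ?thesis using t by blast
    qed
    \<comment> \<open>As K = U + T, the generator \<open>u\<close> of \<open>U\<close> also
      generates modulo \<open>T\<close>. In z = h + t the part h lies in the socle, so the action
      and the commutators of z are those of t, which are trivial modulo \<open>T\<close>.\<close>
    have "infinite_factor A M T K"
      unfolding infinite_factor_def
    proof (intro conjI bexI[of _ u] ballI allI impI)
      show "u \<in> K" using D(4) P(3) by blast
      fix z assume "z \<in> K"
      then obtain h t where ht: "h \<in> U" "t \<in> T" "z = h \<^bold>+ t" using split by blast
      have c: "h \<in> C" "t \<in> C" using ht idealD(14)[OF tor(1)] Ui(14) by auto
      obtain k where "h = k \<^bold>\<cdot> u" using Z(1)[OF ht(1)] by blast
      moreover have "z \<^bold>+ \<^bold>- h = t" using ht c Z(4)[OF ht(1) c(2)] by (simp add: add_simps)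
      ultimately show "\<exists>k. z \<^bold>+ \<^bold>- (k \<^bold>\<cdot> u) \<in> T" using ht by blast
      fix b assume b: "b \<in> C"
      have "z = h \<^bold>* t" using ht c Z(3)[OF ht(1) c(2)] by (simp add: times_eq)
      then have "lam z b = lam t b" using c b Z(3)[OF ht(1)] by (simp add: lam_times)
      then show "lam z b \<^bold>+ \<^bold>- b \<in> T" using ideal_lam_diff[OF tor(1) ht(2) b] by simp
      have "z \<^bold>+ b \<^bold>+ \<^bold>- z \<^bold>+ \<^bold>- b = h \<^bold>+ (t \<^bold>+ b \<^bold>+ \<^bold>- t) \<^bold>+ \<^bold>- h \<^bold>+ \<^bold>- b"
        using ht c b by (simp add: add_simps)
      also have "h \<^bold>+ (t \<^bold>+ b \<^bold>+ \<^bold>- t) = (t \<^bold>+ b \<^bold>+ \<^bold>- t) \<^bold>+ h"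
        using Z(4)[OF ht(1)] c b by simp
      finally have "z \<^bold>+ b \<^bold>+ \<^bold>- z \<^bold>+ \<^bold>- b = t \<^bold>+ b \<^bold>+ \<^bold>- t \<^bold>+ \<^bold>- b"
        using c b by (simp add: add_simps)
      then show "z \<^bold>+ b \<^bold>+ \<^bold>- z \<^bold>+ \<^bold>- b \<in> T" using ideal_commutator[OF tor(1) ht(2) b] by simp
    next
      fix k assume "k \<^bold>\<cdot> u \<in> T"
      then have "(k * int r) \<^bold>\<cdot> u = \<^bold>0" using D(5) by (simp add: T_def add.int_pow_pow)
      then show "k = 0" using Z(2) rpos by fastforce
    qed (use tor(1) P(2) TK in auto)
    then show ?thesis using tor(2) by blast
  next
    case True
    have rt: "t = \<^bold>0" if "t \<in> K" "int r \<^bold>\<cdot> t = \<^bold>0" for t using True that by (auto simp: T_def)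
    have scale_diff: "int r \<^bold>\<cdot> (x \<^bold>+ \<^bold>- y) = int r \<^bold>\<cdot> x \<^bold>+ \<^bold>- (int r \<^bold>\<cdot> y)" if "x \<in> K" "y \<in> K" for x y
    proof -
      have c: "x \<in> C" "y \<in> C" using that Ki(14) by auto
      have "int r \<^bold>\<cdot> (x \<^bold>+ \<^bold>- y) = int r \<^bold>\<cdot> x \<^bold>+ int r \<^bold>\<cdot> \<^bold>- y"
        using commK[OF that(1) Ki(12)[OF that(2)]] c by (intro add.int_pow_mult_distrib) auto
      then show ?thesis using c by (simp add: add.int_pow_inv)
    qed
    \<comment> \<open>Without r-torsion, multiplication by \<open>r\<close> is injective on the
      abelian group \<open>K\<close>. It maps \<open>K\<close> into \<open>U\<close>, so identities
      in \<open>K\<close> can be checked after multiplying by \<open>r\<close>, where the socle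
      property of \<open>U\<close> is available.\<close>
    have cancel: "x = y" if "x \<in> K" "y \<in> K" "int r \<^bold>\<cdot> x = int r \<^bold>\<cdot> y" for x y
    proof (rule eq_of_diff)
      have "int r \<^bold>\<cdot> (x \<^bold>+ \<^bold>- y) = \<^bold>0" using scale_diff[OF that(1,2)] that(3) Ki(14)[OF that(2)] by simp
      then show "x \<^bold>+ \<^bold>- y = \<^bold>0" using rt Ki(11,12) that by blast
    qed (use that Ki(14) in auto)
    obtain k where k: "int r \<^bold>\<cdot> z0 = k \<^bold>\<cdot> u" using Z(1)[OF P(5)[OF z0(1)]] by blast
    have uK: "u \<in> K" using D(4) P(3) by blast
    \<comment> \<open>Otherwise \<open>r\<close> could be cancelled and \<open>z0\<close> would be a
      multiple of \<open>u\<close>.\<close>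
    have "\<not> int r dvd k"
    proof
      assume "int r dvd k"
      then obtain j where "k = j * int r" by (metis dvdE mult.commute)
      then have "int r \<^bold>\<cdot> z0 = int r \<^bold>\<cdot> (j \<^bold>\<cdot> u)" using k D(5) by (simp add: add.int_pow_pow)
      then have "z0 = j \<^bold>\<cdot> u" using cancel[OF z0(1) Ki(13)[OF uK]] by blast
      then show False using z0(2) idealD(13)[OF D(2) D(4)] by blast
    qed
    then have "coprime k (int r)" using r(1) by (metis coprime_commute prime_imp_coprime prime_int_nat_transfer prime_nat_int_transfer)
    then obtain a b where ab: "a * k + b * int r = 1" by (metis bezout_int coprime_imp_gcd_eq_1)
    \<comment> \<open>The Bezout coefficients are chosen to make the r-fold multiple of
      \<open>g\<close> equal to \<open>u\<close>: the infinite factor absorbs the prime one, and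
      \<open>g\<close> is the generator of \<open>K\<close>.\<close>
    define g where "g = a \<^bold>\<cdot> z0 \<^bold>+ b \<^bold>\<cdot> u"
    have gK: "g \<in> K" unfolding g_def using Ki(11,13) z0(1) uK by blast
    then have gC: "g \<in> C" using Ki(14) by blast
    have rg: "int r \<^bold>\<cdot> g = u"
    proof -
      have "int r \<^bold>\<cdot> g = int r \<^bold>\<cdot> (a \<^bold>\<cdot> z0) \<^bold>+ int r \<^bold>\<cdot> (b \<^bold>\<cdot> u)"
        unfolding g_def using commK Ki(13) z0 uK z0C D(5) by (intro add.int_pow_mult_distrib) auto
      also have "int r \<^bold>\<cdot> (a \<^bold>\<cdot> z0) = a \<^bold>\<cdot> (int r \<^bold>\<cdot> z0)" using z0C by (simp add: add.int_pow_pow mult.commute)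
      also have "\<dots> \<^bold>+ int r \<^bold>\<cdot> (b \<^bold>\<cdot> u) = (a * k + b * int r) \<^bold>\<cdot> u"
        using D(5) k by (simp add: add.int_pow_pow add.int_pow_mult mult.commute)
      finally show ?thesis using ab D(5) by simp
    qed
    have gU: "g \<notin> U"
    proof
      assume "g \<in> U"
      then obtain j where "g = j \<^bold>\<cdot> u" using Z(1) by blast
      then have "(j * int r - 1) \<^bold>\<cdot> u = \<^bold>0" using rg D(5) add.int_pow_diff[of u "j * int r" 1] by (simp add: add.int_pow_pow)
      then have "j * int r = 1" using Z(2)[of "j * int r - 1"] by simp
      then have "int r dvd 1" by (metis dvd_triv_right)
      then show False using r(1) by (simp add: prime_nat_iff)
    qed
    have rU: "int r \<^bold>\<cdot> w \<in> U" if "w \<in> K" for w using P(5) that by blast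
    have lamK: "lam w x = x" if w: "w \<in> K" and x: "x \<in> K" for w x
    proof (rule cancel)
      show "int r \<^bold>\<cdot> lam w x = int r \<^bold>\<cdot> x"
        using lam_U[OF w rU[OF x]] Ki(14)[OF w] Ki(14)[OF x] by (simp add: lam_scale)
    qed (use x Ki(7)[OF Ki(14)[OF w] x] in auto)
    have lamw: "lam w b = b" if w: "w \<in> K" and b: "b \<in> C" for w b
    proof -
      have wC: "w \<in> C" using w Ki(14) by blast
      \<comment> \<open>\<open>lam w\<close> fixes \<open>K\<close> pointwise, so its n-th iterate
        shifts \<open>b\<close> by n \<open>f\<close>. For n = r the iterate is the action of an
        element of \<open>U\<close> and hence trivial, which makes \<open>f\<close> an r-torsion
        element.\<close>
      define f where "f = lam w b \<^bold>+ \<^bold>- b"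
      have fK: "f \<in> K" unfolding f_def using ideal_lam_diff[OF P(2) w b] .
      have fC: "f \<in> C" using fK Ki(14) by blast
      have lb: "lam w b = f \<^bold>+ b" using b wC by (simp add: f_def add_simps)
      have "(lam w ^^ n) b = int n \<^bold>\<cdot> f \<^bold>+ b" for n
      proof (induction n)
        case (Suc n)
        have "lam w (int n \<^bold>\<cdot> f) = int n \<^bold>\<cdot> f" using lamK[OF w Ki(13)[OF fK]] .
        then have "(lam w ^^ Suc n) b = int n \<^bold>\<cdot> f \<^bold>+ f \<^bold>+ b"
          using Suc wC fC b lb by (simp add: lam_add add_simps)
        also have "int n \<^bold>\<cdot> f \<^bold>+ f = int (Suc n) \<^bold>\<cdot> f"
          using add.int_pow_mult[OF fC, of "int n" 1] fC by (simp add: add.commute)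
        finally show ?case .
      qed (use b in simp)
      then have "int r \<^bold>\<cdot> f \<^bold>+ b = lam (w [^]\<^bsub>M\<^esub> r) b" using lam_pow[OF wC b] by simp
      also have "\<dots> = b" using Z(3)[OF P(6)[OF w] b] .
      finally have "int r \<^bold>\<cdot> f = \<^bold>0" using fC b by simp
      then have "f = \<^bold>0" using rt fK by blast
      then show ?thesis using lb b by simp
    qed
    have central: "w \<^bold>+ b = b \<^bold>+ w" if w: "w \<in> K" and b: "b \<in> C" for w b
    proof -
      have wC: "w \<in> C" using w Ki(14) by blast
      have "int r \<^bold>\<cdot> (b \<^bold>+ w \<^bold>+ \<^bold>- b) = b \<^bold>+ int r \<^bold>\<cdot> w \<^bold>+ \<^bold>- b"
        using hom_int_pow[OF conj_hom[OF b] wC add.is_group add.is_group] by simp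
      also have "\<dots> = int r \<^bold>\<cdot> w" using Z(4)[OF rU[OF w] b, symmetric] wC b by (simp add: add_simps)
      finally have "b \<^bold>+ w \<^bold>+ \<^bold>- b = w" using cancel[OF Ki(8)[OF b w] w] by blast
      then have "b \<^bold>+ w \<^bold>+ \<^bold>- b \<^bold>+ b = w \<^bold>+ b" by simp
      then show ?thesis using wC b by (simp add: add_simps)
    qed
    have "infinite_factor A M {\<^bold>0} K"
      unfolding infinite_factor_def
    proof (intro conjI bexI[of _ g] ballI allI impI)
      fix z assume z: "z \<in> K"
      then obtain i where i: "z \<^bold>+ \<^bold>- (i \<^bold>\<cdot> g) \<in> U" using P(7)[OF gK gU] by blast
      then obtain j where j: "z \<^bold>+ \<^bold>- (i \<^bold>\<cdot> g) = j \<^bold>\<cdot> u" using Z(1) by blast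
      have zC: "z \<in> C" using z Ki(14) by blast
      have "z = (z \<^bold>+ \<^bold>- (i \<^bold>\<cdot> g)) \<^bold>+ i \<^bold>\<cdot> g" using zC gC by (simp add: add_simps)
      also have "\<dots> = j \<^bold>\<cdot> (int r \<^bold>\<cdot> g) \<^bold>+ i \<^bold>\<cdot> g" using j rg by simp
      also have "\<dots> = (int r * j + i) \<^bold>\<cdot> g" using gC by (simp add: add.int_pow_pow add.int_pow_mult)
      finally have "z \<^bold>+ \<^bold>- ((int r * j + i) \<^bold>\<cdot> g) = \<^bold>0" using gC by simp
      then show "\<exists>k. z \<^bold>+ \<^bold>- (k \<^bold>\<cdot> g) \<in> {\<^bold>0}" by blast
      fix b assume b: "b \<in> C"
      show "lam z b \<^bold>+ \<^bold>- b \<in> {\<^bold>0}" using lamw[OF z b] b by simp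
      show "z \<^bold>+ b \<^bold>+ \<^bold>- z \<^bold>+ \<^bold>- b \<in> {\<^bold>0}" using central[OF z b] b zC by (simp add: add_simps)
    next
      fix k assume "k \<^bold>\<cdot> g \<in> {\<^bold>0}"
      then have "int r \<^bold>\<cdot> (k \<^bold>\<cdot> g) = \<^bold>0" by simp
      then have "k \<^bold>\<cdot> (int r \<^bold>\<cdot> g) = \<^bold>0" using gC by (simp add: add.int_pow_pow mult.commute)
      then show "k = 0" using rg Z(2) by simp
    qed (use ideal_zero P(2) Ki(6) gK in auto)
    then show ?thesis by blast
  qed
qed

text \<open>By \<open>cong\<close> the map preserves each coset of \<open>F\<close>, and all cosets
  have \<open>card F\<close> elements. The same exponent therefore serves for every
  \<open>b\<close>, even when \<open>C\<close> is infinite.\<close>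

lemma funpow_fact_coset:
  assumes F: "ideal F" "finite F" and inj: "inj_on \<phi> C" and cl: "\<phi> ` C \<subseteq> C"
    and cong: "\<And>x. x \<in> C \<Longrightarrow> \<phi> x \<^bold>+ \<^bold>- x \<in> F" and b: "b \<in> C"
  shows "(\<phi> ^^ fact (card F)) b = b"
proof -
  note Fi = idealD[OF F(1)]
  let ?X = "(\<lambda>f. f \<^bold>+ b) ` F"
  have XC: "?X \<subseteq> C" using Fi(14) b by auto
  have "inj_on (\<lambda>f. f \<^bold>+ b) F" using Fi(14) b by (auto intro!: inj_onI)
  then have card: "card ?X = card F" by (rule card_image)
  have "\<phi> ` ?X \<subseteq> ?X"
  proof
    fix y assume "y \<in> \<phi> ` ?X"
    then obtain f where f: "f \<in> F" "y = \<phi> (f \<^bold>+ b)" by blast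
    have c: "f \<in> C" "f \<^bold>+ b \<in> C" "y \<in> C" using f Fi(14) b cl by auto
    have "y \<^bold>+ \<^bold>- (f \<^bold>+ b) \<^bold>+ f \<in> F" using cong[OF c(2)] f Fi(11) by blast
    moreover have "y = y \<^bold>+ \<^bold>- (f \<^bold>+ b) \<^bold>+ f \<^bold>+ b" using c b by (simp add: add_simps)
    ultimately show "y \<in> ?X" by blast
  qed
  moreover have "\<^bold>0 \<^bold>+ b \<in> ?X" using Fi(6) by blast
  then have "b \<in> ?X" using b by simp
  ultimately show ?thesis
    using funpow_fact[of ?X \<phi> b] F(2) inj_on_subset[OF inj XC] card by simp
qed

text \<open>For \<open>m = |F|!\<close> the \<open>m\<close>-th power of a permutation preserving every coset of \<open>F\<close> is trivial. Hence
  taking \<open>m\<close>-th powers of \<open>y\<close> three times yields first an element of the kernel of \<open>\<lambda>\<close>, then one of the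
  socle, and finally one that every \<open>\<lambda>\<^sub>b\<close> maps to a multiple of itself.\<close>

lemma swap_small_infinite_zero:
  assumes F: "small_factor p A M {\<^bold>0} F" and y: "cyclic_mod F I y"
  shows "\<exists>J c. infinite_factor A M {\<^bold>0} J \<and> c \<le> p \<and>
           small_factor p A M J (multiples F y (fact c * fact c * fact c))"
proof -
  note fin = small_factor_zeroD[OF F]
  note D = cyclic_modD[OF y]
  note Fi = idealD[OF D(1)] and Ii = idealD[OF D(2)]
  define m where "m = (fact (card F) :: nat)"
  have m: "m > 0" by (simp add: m_def)
  have mF: "int m \<^bold>\<cdot> f = \<^bold>0" if f: "f \<in> F" for f
  proof -
    have fC: "f \<in> C" using f Fi(14) by blast
    have "((\<lambda>x. f \<^bold>+ x) ^^ m) \<^bold>0 = \<^bold>0"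
      unfolding m_def
    proof (rule funpow_fact_coset[OF D(1) fin(1)])
      show "f \<^bold>+ x \<^bold>+ \<^bold>- x \<in> F" if "x \<in> C" for x using that f fC by (simp add: add_simps)
    qed (use fC in \<open>auto intro!: inj_onI\<close>)
    then show ?thesis using add.mult_funpow[OF fC, of m] by (simp add: int_pow_int)
  qed
  define z where "z = y [^]\<^bsub>M\<^esub> m"
  have yC: "y \<in> C" using D(5) .
  have zC: "z \<in> C" using yC by (simp add: z_def)
  have zI: "z \<in> I" using Ii(16) D(4) by (simp add: z_def)
  have lamz: "lam z b = b" if b: "b \<in> C" for b
    unfolding z_def lam_pow[OF yC b] m_def
    by (rule funpow_fact_coset[OF D(1) fin(1) lam_inj[OF yC] _ D(8)[OF D(4)] b]) (use yC in auto)
  define w where "w = int m \<^bold>\<cdot> z"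
  have wC: "w \<in> C" using zC by (simp add: w_def)
  have lamw: "lam w b = b" if "b \<in> C" for b
    unfolding w_def using lamz that by (intro lam_trivial_scale[OF zC]) auto
  have centw: "w \<^bold>+ b = b \<^bold>+ w" if b: "b \<in> C" for b
  proof -
    have "((\<lambda>x. z \<^bold>+ x \<^bold>+ \<^bold>- z) ^^ m) b = b"
      unfolding m_def
      by (rule funpow_fact_coset[OF D(1) fin(1) add.conj_inj[OF zC] _ D(9)[OF zI] b]) (use zC in auto)
    then have "w \<^bold>+ b \<^bold>+ \<^bold>- w = b" using add.conj_funpow[OF zC b, of m] by (simp add: w_def int_pow_int)
    then have "w \<^bold>+ b \<^bold>+ \<^bold>- w \<^bold>+ w = b \<^bold>+ w" by simp
    then show ?thesis using wC b by (simp add: add_simps)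
  qed
  \<comment> \<open>\<open>y\<close> acts trivially modulo \<open>F\<close>, so its powers in
    \<open>M\<close> agree with its additive multiples there. This locates \<open>z\<close> in the
    coset of m \<open>y\<close>.\<close>
  have "y [^]\<^bsub>M\<^esub> n \<^bold>+ \<^bold>- (int n \<^bold>\<cdot> y) \<in> F" for n :: nat
  proof (induction n)
    case 0
    then show ?case using Fi(6) by simp
  next
    case (Suc n)
    define a where "a = y [^]\<^bsub>M\<^esub> n"
    have aC: "a \<in> C" using yC by (simp add: a_def)
    have "lam y a \<^bold>+ \<^bold>- (int n \<^bold>\<cdot> y) \<in> F"
      using diff_mem_trans[OF D(1) _ aC _ D(8)[OF D(4) aC] Suc[folded a_def]] aC yC by simp
    then have "y \<^bold>+ lam y a \<^bold>+ \<^bold>- (y \<^bold>+ int n \<^bold>\<cdot> y) \<in> F"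
      using add_cong[OF D(1), of y y "lam y a" "int n \<^bold>\<cdot> y"] yC aC Fi(6) by simp
    moreover have "y [^]\<^bsub>M\<^esub> Suc n = y \<^bold>+ lam y a"
      using mult.nat_pow_Suc2[of y n] yC aC by (simp add: a_def times_eq)
    moreover have "y \<^bold>+ int n \<^bold>\<cdot> y = int (Suc n) \<^bold>\<cdot> y"
      using yC by (simp add: add.int_pow_mult)
    ultimately show ?case by simp
  qed
  then have "z \<^bold>+ \<^bold>- (int m \<^bold>\<cdot> y) \<in> F" by (simp add: z_def)
  from scale_cong[OF D(1) zC _ this, of "int m"]
  have wy: "w \<^bold>+ \<^bold>- ((int m * int m) \<^bold>\<cdot> y) \<in> F" using yC by (simp add: w_def add.int_pow_pow)
  define v where "v = int m \<^bold>\<cdot> w"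
  have vC: "v \<in> C" using wC by (simp add: v_def)
  \<comment> \<open>One factor \<open>m\<close> for each of the passages from \<open>y\<close> to
    \<open>z\<close>, to \<open>w\<close> and to \<open>v\<close>.\<close>
  define d where "d = m * m * m"
  have dpos: "d > 0" using m by (simp add: d_def)
  from scale_cong[OF D(1) wC _ wy, of "int m"]
  have vy: "v \<^bold>+ \<^bold>- (int d \<^bold>\<cdot> y) \<in> F" using yC by (simp add: v_def d_def add.int_pow_pow)
  have kvy: "k \<^bold>\<cdot> v \<^bold>+ \<^bold>- ((int d * k) \<^bold>\<cdot> y) \<in> F" for k
    using scale_cong[OF D(1) vC _ vy, of k] yC by (simp add: add.int_pow_pow)
  have cent_scale: "k \<^bold>\<cdot> w \<^bold>+ b = b \<^bold>+ k \<^bold>\<cdot> w" if b: "b \<in> C" for k b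
  proof -
    have "b \<^bold>+ k \<^bold>\<cdot> w \<^bold>+ \<^bold>- b = k \<^bold>\<cdot> (b \<^bold>+ w \<^bold>+ \<^bold>- b)"
      using hom_int_pow[OF conj_hom[OF b] wC add.is_group add.is_group] .
    also have "\<dots> = k \<^bold>\<cdot> w" using centw[OF b, symmetric] b wC by (simp add: add_simps)
    finally have "b \<^bold>+ k \<^bold>\<cdot> w \<^bold>+ \<^bold>- b \<^bold>+ b = k \<^bold>\<cdot> w \<^bold>+ b" by simp
    then show ?thesis using b wC by (simp add: add_simps)
  qed
  have cyc: "cyclic_mod {\<^bold>0} (range (\<lambda>k. k \<^bold>\<cdot> v)) v"
  proof (rule cyclic_zeroI[OF vC])
    show "k = 0" if "k \<^bold>\<cdot> v = \<^bold>0" for k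
    proof -
      have "(int d * k) \<^bold>\<cdot> y \<in> F"
        using diff_mem_swap(1)[OF D(1) _ _ kvy[of k]] that yC by simp
      then show ?thesis using D(7)[of "int d * k"] dpos by simp
    qed
    show "lam v b = b" if "b \<in> C" for b
      unfolding v_def using lamw that by (intro lam_trivial_scale[OF wC]) auto
    show "v \<^bold>+ b = b \<^bold>+ v" if "b \<in> C" for b
      unfolding v_def using cent_scale that .
    show "\<exists>e. lam b v = e \<^bold>\<cdot> v" if b: "b \<in> C" for b
    proof -
      obtain e where e: "lam b y \<^bold>+ \<^bold>- (e \<^bold>\<cdot> y) \<in> F" using D(6) Ii(7)[OF b D(4)] by blast
      have lbw: "lam b w \<in> C" using b wC by simp
      let ?n = "int m * int m"
      have "lam b (w \<^bold>+ \<^bold>- (?n \<^bold>\<cdot> y)) \<in> F" using Fi(7)[OF b wy] .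
      then have 1: "lam b w \<^bold>+ \<^bold>- (?n \<^bold>\<cdot> lam b y) \<in> F"
        using b wC yC by (simp add: lam_add lam_neg lam_scale)
      have 2: "?n \<^bold>\<cdot> lam b y \<^bold>+ \<^bold>- ((e * ?n) \<^bold>\<cdot> y) \<in> F"
        using scale_cong[OF D(1) _ _ e, of ?n] b yC by (simp add: add.int_pow_pow)
      have 3: "(e * ?n) \<^bold>\<cdot> y \<^bold>+ \<^bold>- (e \<^bold>\<cdot> w) \<in> F"
        using diff_mem_swap(1)[OF D(1) _ _ scale_cong[OF D(1) wC _ wy, of e]] wC yC
        by (simp add: add.int_pow_pow mult.commute)
      have "lam b w \<^bold>+ \<^bold>- ((e * ?n) \<^bold>\<cdot> y) \<in> F"
        using diff_mem_trans[OF D(1) lbw _ _ 1 2] b yC by simp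
      then have fF: "lam b w \<^bold>+ \<^bold>- (e \<^bold>\<cdot> w) \<in> F"
        using diff_mem_trans[OF D(1) lbw _ _ _ 3] wC yC by simp
      \<comment> \<open>\<open>lam b w\<close> is a multiple of \<open>w\<close> only up to this
        error in \<open>F\<close>. The third factor \<open>m\<close> kills it, and \<open>m\<close>
        may be distributed because multiples of \<open>w\<close> are central.\<close>
      define f where "f = lam b w \<^bold>+ \<^bold>- (e \<^bold>\<cdot> w)"
      have fC: "f \<in> C" using lbw wC by (simp add: f_def)
      have "lam b w = f \<^bold>+ e \<^bold>\<cdot> w" using lbw wC by (simp add: f_def add_simps)
      then have "lam b v = int m \<^bold>\<cdot> (f \<^bold>+ e \<^bold>\<cdot> w)" using b wC by (simp add: v_def lam_scale)
      also have "\<dots> = int m \<^bold>\<cdot> f \<^bold>+ int m \<^bold>\<cdot> (e \<^bold>\<cdot> w)"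
        using cent_scale[OF fC, of e] fC wC by (intro add.int_pow_mult_distrib) auto
      also have "\<dots> = e \<^bold>\<cdot> v" using mF fF wC by (simp add: f_def v_def add.int_pow_pow mult.commute)
      finally show ?thesis by blast
    qed
  qed
  let ?J = "range (\<lambda>k. k \<^bold>\<cdot> v)" and ?V = "multiples F y d"
  have J: "ideal ?J" using cyclic_modD(2)[OF cyc] .
  \<comment> \<open>Each element of \<open>?V\<close> differs from a multiple of \<open>v\<close> by
    an element of \<open>F\<close>, so \<open>F\<close> supplies the representatives.\<close>
  have "small_factor p A M ?J ?V"
    unfolding small_factor_def
  proof (intro conjI exI[of _ F] ballI)
    show "ideal ?V" using cyclic_modD(2)[OF multiples_cyclic[OF y dpos]] .
    show "?J \<subseteq> ?V" using kvy vC unfolding multiples_def by auto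
    fix x assume "x \<in> ?V"
    then obtain k where x: "x \<in> C" "x \<^bold>+ \<^bold>- ((int d * k) \<^bold>\<cdot> y) \<in> F" unfolding multiples_def by blast
    have "(int d * k) \<^bold>\<cdot> y \<^bold>+ \<^bold>- (k \<^bold>\<cdot> v) \<in> F"
      using diff_mem_swap(1)[OF D(1) _ _ kvy[of k]] vC yC by simp
    then have f: "x \<^bold>+ \<^bold>- (k \<^bold>\<cdot> v) \<in> F"
      using diff_mem_trans[OF D(1) x(1) _ _ x(2)] vC yC by simp
    have "x \<^bold>+ \<^bold>- (x \<^bold>+ \<^bold>- (k \<^bold>\<cdot> v)) = x \<^bold>+ k \<^bold>\<cdot> v \<^bold>+ \<^bold>- x"
      using x(1) vC by (simp add: add_simps)
    also have "\<dots> \<in> ?J" using idealD(8)[OF J x(1)] by blast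
    finally show "\<exists>s\<in>F. x \<^bold>+ \<^bold>- s \<in> ?J" using f by blast
  qed (use J fin Fi in auto)
  then show ?thesis
    using cyc fin(2) unfolding cyclic_mod_def d_def m_def by blast
qed

end

subsection \<open>Chains of ideals\<close>

text \<open>The index counts infinite factors only. It is the measure of the final induction, in
  which small factors may multiply freely.\<close>

inductive factor_chain ::
    "nat \<Rightarrow> ('a, 'm) monoid_scheme \<Rightarrow> ('a, 'n) monoid_scheme \<Rightarrow> nat \<Rightarrow> 'a set \<Rightarrow> 'a set \<Rightarrow> bool"
  for p A M where
  refl: "brace_ideal A M K \<Longrightarrow> factor_chain p A M 0 K K"
| small: "factor_chain p A M h K L \<Longrightarrow> small_factor p A M L L' \<Longrightarrow> factor_chain p A M h K L'"
| infinite: "factor_chain p A M h K L \<Longrightarrow> infinite_factor A M L L' \<Longrightarrow> factor_chain p A M (Suc h) K L'"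

context skew_brace
begin

lemma factor_chain_ideals: "factor_chain p A M h K L \<Longrightarrow> ideal K \<and> ideal L \<and> K \<subseteq> L"
  by (induction rule: factor_chain.induct) (auto dest: factor_ideals)

lemma factor_chain_trans:
  "factor_chain p A M h' L L' \<Longrightarrow> factor_chain p A M h K L \<Longrightarrow> factor_chain p A M (h + h') K L'"
  by (induction rule: factor_chain.induct) (auto intro: factor_chain.intros)

lemma factor_chain_small: "small_factor p A M K L \<Longrightarrow> factor_chain p A M 0 K L"
  using factor_ideals(2) factor_chain.refl factor_chain.small by blast

lemma multiples_chain:
  assumes c: "cyclic_mod K L y" and "d > 0" "e > 0" "factor_chain p A M 0 (multiples K y d) L" "e \<le> p"
  shows "factor_chain p A M 0 (multiples K y (d * e)) L"
  using factor_chain_trans[OF assms(4) factor_chain_small[OF multiples_small_factor[OF c assms(2,3,5)]]] by simp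

text \<open>The index n! is reached through the successive indices 1, ..., n, each at most
  \<open>p\<close>. This is why the exchange of a small with an infinite factor reports its index as
  a product of factorials.\<close>

lemma multiples_chain_fact:
  assumes c: "cyclic_mod K L y" and d: "d > 0" "factor_chain p A M 0 (multiples K y d) L" and "n \<le> p"
  shows "factor_chain p A M 0 (multiples K y (d * fact n)) L"
  using assms(4)
proof (induction n)
  case (Suc n)
  have "factor_chain p A M 0 (multiples K y (d * fact n * Suc n)) L"
    using multiples_chain[OF c, of "d * fact n" "Suc n" p] Suc d(1) by simp
  moreover have "d * fact n * Suc n = d * fact (Suc n)" by (simp add: algebra_simps)
  ultimately show ?case by metis
qed (use d in simp)

text \<open>Every doubling is a small step because \<open>2 \<le> p\<close>.\<close>

lemma multiples_chain_power:
  assumes c: "cyclic_mod K L y" and "2 \<le> p"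
  shows "factor_chain p A M 0 (multiples K y (2 ^ n)) L"
proof (induction n)
  case 0
  then show ?case using multiples_one[OF c] cyclic_modD(2)[OF c] factor_chain.refl by simp
next
  case (Suc n)
  have "factor_chain p A M 0 (multiples K y (2 ^ n * 2)) L"
    using Suc assms(2) by (intro multiples_chain[OF c]) auto
  then show ?case by (simp add: mult.commute)
qed

section \<open>Exchanges over an arbitrary bottom ideal\<close>

lemma swap_small_prime:
  assumes "small_factor p A M K L" "prime_factor r A M L L'" "Factorial_Ring.prime r" "p < r"
  shows "\<exists>T. prime_factor r A M K T \<and> small_factor p A M T L'"
proof -
  note i = factor_ideals(2)[OF assms(1)] factor_ideals(3)[OF assms(2)]
  have K: "ideal K" "K \<subseteq> K" and L: "ideal L" "K \<subseteq> L" and L': "ideal L'" "K \<subseteq> L'" using i by auto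
  define q where "q = (\<lambda>x. K #>\<^bsub>A\<^esub> x)"
  interpret q: brace_epi A M "A Mod K" "M Mod K" q K
    unfolding q_def by (rule brace_epi_Mod[OF K(1)])
  have 1: "small_factor p (A Mod K) (M Mod K) {q.Q.zero} (q ` L)"
    using assms(1) q.small_factor_proj[OF K L, unfolded q.proj_N] by blast
  have 2: "prime_factor r (A Mod K) (M Mod K) (q ` L) (q ` L')"
    using assms(2) q.prime_factor_proj[OF L L'] by blast
  obtain W where W: "prime_factor r (A Mod K) (M Mod K) {q.Q.zero} W"
      "small_factor p (A Mod K) (M Mod K) W (q ` L')"
    using q.Q.swap_small_prime_zero[OF 1 2 assms(3,4)] by blast
  have "q.Q.ideal W" using q.Q.factor_ideals(3)[OF W(1)] by blast
  from q.ideal_vimage[OF this] obtain T where T: "ideal T" "K \<subseteq> T" "W = q ` T" by blast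
  have "prime_factor r A M K T"
    using W(1)[unfolded T(3)] q.prime_factor_proj[OF K T(1,2), unfolded q.proj_N] by blast
  moreover have "small_factor p A M T L'"
    using W(2)[unfolded T(3)] q.small_factor_proj[OF T(1,2) L'] by blast
  ultimately show ?thesis by blast
qed

lemma swap_infinite_prime:
  assumes "infinite_factor A M K L" "prime_factor r A M L L'" "Factorial_Ring.prime r" "odd r"
  shows "infinite_factor A M K L' \<or> (\<exists>T. prime_factor r A M K T \<and> infinite_factor A M T L')"
proof -
  note i = factor_ideals(1)[OF assms(1)] factor_ideals(3)[OF assms(2)]
  have K: "ideal K" "K \<subseteq> K" and L: "ideal L" "K \<subseteq> L" and L': "ideal L'" "K \<subseteq> L'" using i by auto
  define q where "q = (\<lambda>x. K #>\<^bsub>A\<^esub> x)"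
  interpret q: brace_epi A M "A Mod K" "M Mod K" q K
    unfolding q_def by (rule brace_epi_Mod[OF K(1)])
  have "infinite_factor (A Mod K) (M Mod K) {q.Q.zero} (q ` L)"
    using assms(1) q.infinite_factor_proj[OF K L, unfolded q.proj_N] by blast
  moreover have "prime_factor r (A Mod K) (M Mod K) (q ` L) (q ` L')"
    using assms(2) q.prime_factor_proj[OF L L'] by blast
  ultimately consider "infinite_factor (A Mod K) (M Mod K) {q.Q.zero} (q ` L')" |
    W where "prime_factor r (A Mod K) (M Mod K) {q.Q.zero} W" "infinite_factor (A Mod K) (M Mod K) W (q ` L')"
    using q.Q.swap_infinite_prime_zero assms(3,4) by blast
  then show ?thesis
  proof cases
    case 2
    have "q.Q.ideal W" using q.Q.factor_ideals(3)[OF 2(1)] by blast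
    from q.ideal_vimage[OF this] obtain T where T: "ideal T" "K \<subseteq> T" "W = q ` T" by blast
    have "prime_factor r A M K T"
      using 2(1)[unfolded T(3)] q.prime_factor_proj[OF K T(1,2), unfolded q.proj_N] by blast
    moreover have "infinite_factor A M T L'"
      using 2(2)[unfolded T(3)] q.infinite_factor_proj[OF T(1,2) L'] by blast
    ultimately show ?thesis by blast
  next
    case 1
    then show ?thesis using q.infinite_factor_proj[OF K L', unfolded q.proj_N] by blast
  qed
qed

text \<open>The exchange in the quotient by \<open>K\<close> stops at an ideal of index (c!)^3 in
  \<open>L'\<close>; the rest of the way up is filled by three runs of
  \<open>multiples_chain_fact\<close>.\<close>

lemma swap_small_infinite:
  assumes F: "small_factor p A M K L" and y: "infinite_factor A M L L'"
  shows "\<exists>J. infinite_factor A M K J \<and> factor_chain p A M 0 J L'"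
proof -
  obtain y where y: "cyclic_mod L L' y" using y infinite_factor_cyclic by blast
  note D = cyclic_modD[OF y]
  have K: "ideal K" "K \<subseteq> K" and L: "ideal L" "K \<subseteq> L" using factor_ideals(2)[OF F] by auto
  define q where "q = (\<lambda>x. K #>\<^bsub>A\<^esub> x)"
  interpret q: brace_epi A M "A Mod K" "M Mod K" q K
    unfolding q_def by (rule brace_epi_Mod[OF K(1)])
  let ?V = "\<lambda>d. q.Q.multiples (q ` L) (q y) d"
  have 1: "small_factor p (A Mod K) (M Mod K) {q.Q.zero} (q ` L)"
    using F q.small_factor_proj[OF K L, unfolded q.proj_N] by blast
  obtain W c where W: "infinite_factor (A Mod K) (M Mod K) {q.Q.zero} W" "c \<le> p"
      "small_factor p (A Mod K) (M Mod K) W (?V (fact c * fact c * fact c))"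
    using q.Q.swap_small_infinite_zero[OF 1 q.cyclic_mod_proj[OF y L(2)]] by blast
  define d :: nat where "d = fact c * fact c * fact c"
  have d: "d > 0" by (simp add: d_def)
  have "q.Q.ideal W" "q.Q.ideal (?V d)"
    using q.Q.factor_ideals(2)[OF W(3)] by (auto simp: d_def)
  note v = q.ideal_vimage[OF this(1)] and v' = q.ideal_vimage[OF this(2)]
  obtain J where J: "ideal J" "K \<subseteq> J" "W = q ` J" using v by blast
  have eq: "{x \<in> C. q x \<in> ?V d} = multiples L y d" by (rule q.multiples_proj[OF L D(5)])
  note V = v'[unfolded eq]
  have "infinite_factor A M K J"
    using W(1) unfolding J(3) q.proj_N[symmetric] q.infinite_factor_proj[OF K J(1,2)] .
  moreover have "small_factor p A M J (multiples L y d)"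
    using W(3) unfolding J(3) d_def[symmetric] V(3)[symmetric] q.small_factor_proj[OF J(1,2) V(1,2)] .
  moreover have "factor_chain p A M 0 (multiples L y d) L'"
  proof -
    have "factor_chain p A M 0 (multiples L y 1) L'"
      using multiples_one[OF y] D(2) factor_chain.refl by simp
    then have "factor_chain p A M 0 (multiples L y (1 * fact c)) L'"
      using multiples_chain_fact[OF y _ _ W(2), of 1] by simp
    then have "factor_chain p A M 0 (multiples L y (fact c * fact c)) L'"
      using multiples_chain_fact[OF y _ _ W(2), of "fact c"] by simp
    then show ?thesis
      using multiples_chain_fact[OF y _ _ W(2), of "fact c * fact c"] by (simp add: d_def)
  qed
  ultimately show ?thesis
    using factor_chain_trans[OF _ factor_chain_small] by fastforce
qed

text \<open>The small factors created by an exchange lie above the infinite factor and never have to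
  be crossed again, so induction along the original chain suffices.\<close>

lemma infinite_factor_to_bottom:
  "factor_chain p A M h K F \<Longrightarrow> h = 0 \<Longrightarrow> infinite_factor A M F I \<Longrightarrow>
     \<exists>Y. infinite_factor A M K Y \<and> factor_chain p A M 0 Y I"
proof (induction arbitrary: I rule: factor_chain.induct)
  case (refl K)
  then show ?case using factor_ideals(1) factor_chain.refl by blast
next
  case (small h K L L')
  obtain J where J: "infinite_factor A M L J" "factor_chain p A M 0 J I"
    using swap_small_infinite[OF small(2) small(5)] by blast
  obtain Y where "infinite_factor A M K Y" "factor_chain p A M 0 Y J"
    using small(3)[OF small(4) J(1)] by blast
  then show ?case using factor_chain_trans[OF J(2)] by force
qed simp

lemma factor_chain_first_infinite:
  "factor_chain p A M h K L \<Longrightarrow> h > 0 \<Longrightarrow> \<exists>Y. infinite_factor A M K Y \<and> factor_chain p A M (h - 1) Y L"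
proof (induction rule: factor_chain.induct)
  case (small h K L L')
  then show ?case using factor_chain.small by blast
next
  case (infinite h K L L')
  show ?case
  proof (cases "h = 0")
    case True
    then show ?thesis using infinite_factor_to_bottom infinite by simp
  next
    case False
    then obtain Y where "infinite_factor A M K Y" "factor_chain p A M (h - 1) Y L" using infinite by blast
    then show ?thesis using factor_chain.infinite[OF _ infinite(2)] False by fastforce
  qed
qed simp

text \<open>Otherwise \<open>x\<close> is congruent to i \<open>y\<close> modulo \<open>K\<close>
  with i nonzero and divisible by every power of 2, because i is determined by the coset of
  \<open>x\<close>.\<close>

lemma multiples_avoid:
  assumes c: "cyclic_mod K L y" and x: "x \<notin> K" "x \<in> C"
  shows "\<exists>n. x \<notin> multiples K y (2 ^ n)"
proof (rule ccontr)
  note D = cyclic_modD[OF c]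
  assume "\<not> ?thesis"
  then have all: "\<exists>k. x \<^bold>+ \<^bold>- ((int (2 ^ n) * k) \<^bold>\<cdot> y) \<in> K" for n unfolding multiples_def by blast
  obtain i where i: "x \<^bold>+ \<^bold>- (i \<^bold>\<cdot> y) \<in> K" using all[of 0] by auto
  have "i \<noteq> 0" using i x by auto
  have dvd: "2 ^ n dvd i" for n
  proof -
    obtain k where k: "x \<^bold>+ \<^bold>- ((int (2 ^ n) * k) \<^bold>\<cdot> y) \<in> K" using all by blast
    have "i \<^bold>\<cdot> y \<^bold>+ \<^bold>- ((int (2 ^ n) * k) \<^bold>\<cdot> y) \<in> K"
      using diff_mem_trans[OF D(1) _ x(2) _ diff_mem_swap(1)[OF D(1) x(2) _ i] k] D(5) by simp
    then have "(i - int (2 ^ n) * k) \<^bold>\<cdot> y \<in> K"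
      using D(5) by (simp add: add.int_pow_diff)
    then have "i = int (2 ^ n) * k" using D(7) by fastforce
    then show ?thesis by simp
  qed
  have "2 ^ nat \<bar>i\<bar> \<le> \<bar>i\<bar>" using dvd_imp_le_int[OF \<open>i \<noteq> 0\<close> dvd[of "nat \<bar>i\<bar>"]] by simp
  moreover have "\<bar>i\<bar> < 2 ^ nat \<bar>i\<bar>"
    using of_nat_less_two_power[of "nat \<bar>i\<bar>", where 'a = int] by simp
  ultimately show False by simp
qed

text \<open>The bottom is raised from \<open>N\<close> to an ideal that still misses
  \<open>x\<close>. What is left of the lowest infinite factor above it is a run of steps of index
  2, so the chain has lost one infinite factor.\<close>

lemma residually_small:
  assumes p: "2 \<le> p"
  shows "factor_chain p A M h N C \<Longrightarrow> x \<in> C \<Longrightarrow> x \<notin> N \<Longrightarrow> \<exists>N'. factor_chain p A M 0 N' C \<and> x \<notin> N'"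
proof (induction h arbitrary: N)
  case (Suc h)
  obtain Y where Y: "infinite_factor A M N Y" "factor_chain p A M h Y C"
    using factor_chain_first_infinite[OF Suc.prems(1)] by auto
  obtain y where y: "cyclic_mod N Y y" using Y(1) infinite_factor_cyclic by blast
  obtain n where n: "x \<notin> multiples N y (2 ^ n)" using multiples_avoid[OF y Suc.prems(3,2)] by blast
  have "factor_chain p A M h (multiples N y (2 ^ n)) C"
    using factor_chain_trans[OF Y(2) multiples_chain_power[OF y p]] by simp
  then show ?case using Suc.IH n Suc.prems(2) by blast
qed (intro exI conjI)

text \<open>\<open>K' = K\<close> means that some infinite factor absorbed the prime one on its way
  down; otherwise it has arrived at the very bottom.\<close>

lemma push_prime_factor:
  assumes r: "Factorial_Ring.prime r" "odd r" "p < r"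
  shows "factor_chain p A M h K L \<Longrightarrow> prime_factor r A M L L' \<Longrightarrow>
     \<exists>K' h'. (K' = K \<or> prime_factor r A M K K') \<and> factor_chain p A M h' K' L'"
proof (induction arbitrary: L' rule: factor_chain.induct)
  case (refl K)
  then have "factor_chain p A M 0 L' L'" using factor_ideals(3)[OF refl(2)] factor_chain.refl by blast
  then show ?case using refl(2) by blast
next
  case (small h K L1 L2)
  obtain T where "prime_factor r A M L1 T" "small_factor p A M T L'"
    using swap_small_prime[OF small(2) small(4) r(1,3)] by blast
  note T = this
  obtain K' h' where K': "K' = K \<or> prime_factor r A M K K'" "factor_chain p A M h' K' T"
    using small(3)[OF T(1)] by blast
  have "factor_chain p A M h' K' L'" using factor_chain.small[OF K'(2) T(2)] .
  then show ?case using K'(1) by blast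
next
  case (infinite h K L1 L2)
  consider "infinite_factor A M L1 L'" | T where "prime_factor r A M L1 T" "infinite_factor A M T L'"
    using swap_infinite_prime[OF infinite(2) infinite(4) r(1,2)] by blast
  then show ?case
  proof cases
    case 1
    have "factor_chain p A M (Suc h) K L'" using factor_chain.infinite[OF infinite(1) 1] .
    then show ?thesis by blast
  next
    case 2
    obtain K' h' where K': "K' = K \<or> prime_factor r A M K K'" "factor_chain p A M h' K' T"
      using infinite(3)[OF 2(1)] by blast
    have "factor_chain p A M (Suc h') K' L'" using factor_chain.infinite[OF K'(2) 2(2)] .
    then show ?thesis using K'(1) by blast
  qed
qed

text \<open>At the bottom, torsion in the factor is torsion in B itself, which the spectrum
  sees.\<close>

lemma prime_factor_zero_spectrum:
  assumes "prime_factor r A M {\<^bold>0} K" "Factorial_Ring.prime r"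
  shows "r \<in> add_prime_spectrum A"
proof -
  note P = prime_factorD[OF assms(1)]
  obtain x where x: "x \<in> K" "x \<noteq> \<^bold>0" using P(3,4) by blast
  have xC: "x \<in> C" using x idealD(14)[OF P(2)] by blast
  have "x [^]\<^bsub>A\<^esub> r = \<^bold>0" using P(5)[OF x(1)] by (simp add: int_pow_int)
  then have "add.ord x dvd r" using add.pow_eq_id[OF xC] by blast
  moreover have "add.ord x \<noteq> 1" using add.ord_eq_1[OF xC] x(2) by simp
  ultimately have "add.ord x = r" using assms(2) by (metis prime_nat_iff)
  then show ?thesis using xC assms(2) unfolding add_prime_spectrum_def by blast
qed

section \<open>Finiteness and prime divisors of the resulting quotients\<close>

lemma factor_chain_smooth:
  assumes "factor_chain p A M h N L" "h = 0" "z \<in> L" "Factorial_Ring.prime q" "p < q" "int q \<^bold>\<cdot> z \<in> N"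
  shows "z \<in> N"
  using assms
proof (induction rule: factor_chain.induct)
  case (small h K L L')
  obtain S where S: "S \<subseteq> C" "finite S" "card S \<le> p" "\<And>w. w \<in> L' \<Longrightarrow> \<exists>s\<in>S. w \<^bold>+ \<^bold>- s \<in> L"
    using small(2) unfolding small_factor_def by blast
  have L: "ideal L" and L': "ideal L'" using factor_ideals(2)[OF small(2)] by auto
  have zC: "z \<in> C" using idealD(14)[OF L'] small.prems by blast
  have zk: "int k \<^bold>\<cdot> z \<in> L'" for k :: nat using idealD(13)[OF L'] small.prems by blast
  obtain s where s: "\<And>k :: nat. s k \<in> S \<and> int k \<^bold>\<cdot> z \<^bold>+ \<^bold>- s k \<in> L" using S(4)[OF zk] by metis
  \<comment> \<open>The q multiples 0, z, ..., (q-1)z fall into fewer than q cosets of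
    \<open>L\<close>. Two of them differ by a multiple (j - i) \<open>z\<close> in \<open>L\<close>
    with j - i prime to \<open>q\<close>; since q \<open>z\<close> is in \<open>L\<close> too, so is
    \<open>z\<close>, and the descent continues.\<close>
  have "\<not> inj_on s {..<q}"
    using card_inj_on_le[of s "{..<q}" S] s S(2,3) small.prems by auto
  then obtain i j where ij: "i < j" "j < q" "s i = s j"
    unfolding inj_on_def by (metis lessThan_iff linorder_neqE_nat)
  have sC: "s k \<in> C" for k using s S(1) by blast
  have "int j \<^bold>\<cdot> z \<^bold>+ \<^bold>- (int i \<^bold>\<cdot> z) \<in> L"
  proof (rule diff_mem_trans[OF L _ sC[of i]])
    show "s i \<^bold>+ \<^bold>- (int i \<^bold>\<cdot> z) \<in> L"
      using diff_mem_swap(1)[OF L _ sC[of i], of "int i \<^bold>\<cdot> z"] s[of i] zC by simp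
    show "int j \<^bold>\<cdot> z \<^bold>+ \<^bold>- s i \<in> L" using s[of j] ij(3) by simp
  qed (use zC in simp_all)
  then have "(int j - int i) \<^bold>\<cdot> z \<in> L" using zC by (simp add: add.int_pow_diff)
  moreover have "int q \<^bold>\<cdot> z \<in> L"
    using small.prems factor_chain_ideals[OF small(1)] by blast
  moreover have "coprime (int j - int i) (int q)"
  proof -
    have "\<not> q dvd (j - i)" using ij by (auto dest: dvd_imp_le)
    then have "coprime (j - i) q" using small.prems by (metis coprime_commute prime_imp_coprime)
    then have "coprime (int (j - i)) (int q)" by simp
    then show ?thesis using ij by (simp add: of_nat_diff)
  qed
  ultimately have "z \<in> L" by (rule add.coprime_pow_mem[OF idealD(1)[OF L] zC])
  then show ?case using small.IH small.prems by blast
qed simp_all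

lemma factor_chain_finite:
  assumes "factor_chain p A M h N L" "h = 0"
  shows "\<exists>S\<subseteq>C. finite S \<and> (\<forall>z\<in>L. \<exists>s\<in>S. z \<^bold>+ \<^bold>- s \<in> N)"
  using assms
proof (induction rule: factor_chain.induct)
  case (refl K)
  have "\<exists>s\<in>{\<^bold>0}. z \<^bold>+ \<^bold>- s \<in> K" if "z \<in> K" for z using that idealD(14)[OF refl(1) that] by simp
  moreover have "{\<^bold>0} \<subseteq> C" "finite {\<^bold>0}" by simp_all
  ultimately show ?case by blast
next
  case (small h N L L')
  obtain S where S: "S \<subseteq> C" "finite S" "\<And>z. z \<in> L \<Longrightarrow> \<exists>s\<in>S. z \<^bold>+ \<^bold>- s \<in> N" using small.IH small.prems by blast
  obtain S' where S': "S' \<subseteq> C" "finite S'" "\<And>z. z \<in> L' \<Longrightarrow> \<exists>s\<in>S'. z \<^bold>+ \<^bold>- s \<in> L"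
    using small(2) unfolding small_factor_def by blast
  define U where "U = (\<Union>s\<in>S. (\<lambda>t. s \<^bold>+ t) ` S')"
  have L': "ideal L'" using factor_ideals(2)[OF small(2)] by blast
  have "\<exists>u\<in>U. z \<^bold>+ \<^bold>- u \<in> N" if z: "z \<in> L'" for z
  proof -
    obtain t where t: "t \<in> S'" "z \<^bold>+ \<^bold>- t \<in> L" using S'(3)[OF z] by blast
    obtain s where s: "s \<in> S" "z \<^bold>+ \<^bold>- t \<^bold>+ \<^bold>- s \<in> N" using S(3)[OF t(2)] by blast
    have c: "s \<in> C" "t \<in> C" "z \<in> C"
      using subsetD[OF S(1) s(1)] subsetD[OF S'(1) t(1)] idealD(14)[OF L' z] by simp_all
    have "z \<^bold>+ \<^bold>- (s \<^bold>+ t) = z \<^bold>+ \<^bold>- t \<^bold>+ \<^bold>- s" using c by (simp add: add_simps)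
    then have "z \<^bold>+ \<^bold>- (s \<^bold>+ t) \<in> N" using s(2) by simp
    moreover have "s \<^bold>+ t \<in> U" unfolding U_def using s(1) t(1) by blast
    ultimately show ?thesis by blast
  qed
  moreover have "U \<subseteq> C"
  proof
    fix x assume "x \<in> U"
    then obtain s t where "s \<in> S" "t \<in> S'" "x = s \<^bold>+ t" unfolding U_def by blast
    then show "x \<in> C" using subsetD[OF S(1)] subsetD[OF S'(1)] by simp
  qed
  moreover have "finite U" unfolding U_def using S(2) S'(2) by simp
  ultimately show ?case by blast
next
  case infinite
  then show ?case by (metis nat.distinct(1))
qed

lemma finite_quotient:
  assumes chain: "factor_chain p A M 0 N C"
  shows "finite (carrier (A Mod N))"
    and "Factorial_Ring.prime q \<Longrightarrow> q dvd card (carrier (A Mod N)) \<Longrightarrow> q \<le> p"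
proof -
  have N: "ideal N" using factor_chain_ideals[OF chain] by blast
  define \<pi> where "\<pi> = (\<lambda>x. N #>\<^bsub>A\<^esub> x)"
  interpret q: brace_epi A M "A Mod N" "M Mod N" \<pi> N
    unfolding \<pi>_def by (rule brace_epi_Mod[OF N])
  obtain S where S: "S \<subseteq> C" "finite S" "\<And>z. z \<in> C \<Longrightarrow> \<exists>s\<in>S. z \<^bold>+ \<^bold>- s \<in> N"
    using factor_chain_finite[OF chain] by blast
  have "carrier (A Mod N) \<subseteq> \<pi> ` S"
    unfolding q.proj_onto[symmetric] using S(1,3) q.proj_eq_iff by (smt (verit) image_iff subsetD subsetI)
  then show fin: "finite (carrier (A Mod N))" using S(2) finite_surj by blast
  show "q \<le> p" if q: "Factorial_Ring.prime q" "q dvd card (carrier (A Mod N))"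
  proof (rule ccontr)
    assume "\<not> q \<le> p"
    \<comment> \<open>With exponent 1 Sylow's theorem becomes Cauchy's: all that matters is a
      nonzero element killed by \<open>q\<close>.\<close>
    obtain m where "order (A Mod N) = q ^ 1 * m" using q(2) by (auto simp: order_def)
    from sylow_thm[OF _ _ this fin] obtain H where H: "subgroup H (A Mod N)" "card H = q"
      using q(1) q.Q.add.is_group by auto
    have "H \<noteq> {q.Q.zero}" using H(2) q(1) by auto
    then obtain t where t: "t \<in> H" "t \<noteq> q.Q.zero" using subgroup.one_closed[OF H(1)] by blast
    obtain z where z: "z \<in> C" "t = \<pi> z"
      using t(1) subgroup.subset[OF H(1)] unfolding q.proj_onto[symmetric] by blast
    have "finite H" using H(2) q(1) by (metis card.infinite not_prime_0)
    then have "t [^]\<^bsub>A Mod N\<^esub> q = q.Q.zero"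
      using q.Q.add.subgroup_pow_card[OF H(1) _ t(1)] unfolding H(2) by blast
    then have "\<pi> (int q \<^bold>\<cdot> z) = q.Q.zero" using q.proj_simps(4)[OF z(1), of "int q"] z by (simp add: int_pow_int)
    then have "int q \<^bold>\<cdot> z \<in> N" using q.ker z(1) by simp
    then have "z \<in> N" using factor_chain_smooth[OF chain _ z(1) q(1)] \<open>\<not> q \<le> p\<close> by simp
    then show False using q.ker z t(2) by simp
  qed
qed

section \<open>From conditions on cosets to elementwise factors\<close>

context
  fixes K L assumes K: "ideal K" and L: "ideal L" and KL: "K \<subseteq> L"
begin

lemma small_factor_cosets:
  assumes "finite ((\<lambda>x. K #>\<^bsub>A\<^esub> x) ` L)" "card ((\<lambda>x. K #>\<^bsub>A\<^esub> x) ` L) \<le> p"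
  shows "small_factor p A M K L"
proof -
  define q where "q = (\<lambda>x. K #>\<^bsub>A\<^esub> x)"
  interpret q: brace_epi A M "A Mod K" "M Mod K" q K
    unfolding q_def by (rule brace_epi_Mod[OF K])
  obtain S where S: "S \<subseteq> L" "inj_on q S" "q ` L = q ` S" by (meson subset_image_inj order_refl)
  note LC = idealD(14)[OF L]
  have "finite S" "card S \<le> p"
    using assms S(2) unfolding q_def[symmetric] S(3) by (auto simp: card_image finite_image_iff)
  moreover have "\<exists>s\<in>S. z \<^bold>+ \<^bold>- s \<in> K" if z: "z \<in> L" for z
  proof -
    obtain s where s: "s \<in> S" "q z = q s" using S(3) z by blast
    then show ?thesis using q.proj_eq_iff[OF LC[OF z] LC] S(1) by blast
  qed
  moreover have "S \<subseteq> C" using S(1) idealD(5)[OF L] by blast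
  ultimately show ?thesis unfolding small_factor_def using K L KL by blast
qed

lemma prime_factor_cosets:
  assumes "Factorial_Ring.prime (card ((\<lambda>x. K #>\<^bsub>A\<^esub> x) ` L))"
  shows "prime_factor (card ((\<lambda>x. K #>\<^bsub>A\<^esub> x) ` L)) A M K L"
proof -
  define q where "q = (\<lambda>x. K #>\<^bsub>A\<^esub> x)"
  interpret q: brace_epi A M "A Mod K" "M Mod K" q K
    unfolding q_def by (rule brace_epi_Mod[OF K])
  note LC = idealD(14)[OF L]
  define r where "r = card (q ` L)"
  have r: "Factorial_Ring.prime r" using assms by (simp add: r_def q_def)
  have fin: "finite (q ` L)" using r by (metis card.infinite not_prime_0 r_def)
  have qL: "q.Q.ideal (q ` L)" using q.ideal_proj[OF L] .
  note sub = q.Q.idealD(1,2)[OF qL]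
  have "K \<noteq> L"
  proof
    assume "K = L"
    then have "r = 1" unfolding r_def using q.proj_N by simp
    then show False using r by simp
  qed
  moreover have "int r \<^bold>\<cdot> z \<in> K" "z [^]\<^bsub>M\<^esub> r \<in> K" if z: "z \<in> L" for z
  proof -
    have "q (int r \<^bold>\<cdot> z) = q.Q.zero"
      using q.Q.add.subgroup_pow_card[OF sub(1) fin, of "q z"] z q.proj_simps(4)[OF LC[OF z], of "int r"]
      by (simp add: r_def int_pow_int)
    then show "int r \<^bold>\<cdot> z \<in> K" using q.ker LC[OF z] by simp
    have "q (z [^]\<^bsub>M\<^esub> r) = \<one>\<^bsub>M Mod K\<^esub>"
      using q.Q.mult.subgroup_pow_card[OF sub(2) fin, of "q z"] z q.proj_simps(5)[OF LC[OF z], of r]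
      by (simp add: r_def)
    then have "q (z [^]\<^bsub>M\<^esub> r) = q.Q.zero" unfolding q.Q.one_M .
    then show "z [^]\<^bsub>M\<^esub> r \<in> K" using q.ker LC[OF z] by simp
  qed
  moreover have "\<exists>k. w \<^bold>+ \<^bold>- (k \<^bold>\<cdot> z) \<in> K" if z: "z \<in> L" "z \<notin> K" and w: "w \<in> L" for z w
  proof -
    have "q z \<noteq> q.Q.zero" using q.ker LC[OF z(1)] z(2) by blast
    then obtain k :: int where "q w = q z [^]\<^bsub>A Mod K\<^esub> k"
      using q.Q.add.prime_subgroup_cyclic[OF sub(1) r[unfolded r_def] imageI[OF z(1)] _ imageI[OF w]] by blast
    then have "q w = q (k \<^bold>\<cdot> z)" using q.proj_simps(4)[OF LC[OF z(1)]] by simp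
    then have "w \<^bold>+ \<^bold>- (k \<^bold>\<cdot> z) \<in> K" using q.proj_eq_iff[OF LC[OF w]] LC[OF z(1)] by simp
    then show ?thesis by blast
  qed
  ultimately have "prime_factor r A M K L"
    unfolding prime_factor_def using K L KL by blast
  then show ?thesis by (simp add: r_def q_def)
qed

lemma infinite_factor_cosets:
  assumes iso: "((A\<lparr>carrier := L\<rparr>) Mod K) \<cong> integer_group"
    and soc: "(\<lambda>x. K #>\<^bsub>A\<^esub> x) ` L \<subseteq> brace_socle (A Mod K) (M Mod K)"
  shows "infinite_factor A M K L"
proof -
  define q where "q = (\<lambda>x. K #>\<^bsub>A\<^esub> x)"
  interpret q: brace_epi A M "A Mod K" "M Mod K" q K
    unfolding q_def by (rule brace_epi_Mod[OF K])
  note LC = idealD(14)[OF L]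
  have "lam z b \<^bold>+ \<^bold>- b \<in> K \<and> z \<^bold>+ b \<^bold>+ \<^bold>- z \<^bold>+ \<^bold>- b \<in> K" if z: "z \<in> L" and b: "b \<in> C" for z b
  proof -
    have "q z \<in> brace_socle (A Mod K) (M Mod K)" using soc z unfolding q_def by blast
    then have "q.Q.lam (q z) (q b) = q b" "q.Q.plus (q z) (q b) = q.Q.plus (q b) (q z)"
      using q.proj_closed[OF b] unfolding brace_socle_def by blast+
    then have "q (lam z b) = q b" "q (z \<^bold>+ b) = q (b \<^bold>+ z)"
      unfolding q.proj_simps(7)[OF LC[OF z] b] q.proj_simps(1)[OF LC[OF z] b] q.proj_simps(1)[OF b LC[OF z]]
      by blast+
    then have "lam z b \<^bold>+ \<^bold>- b \<in> K" "z \<^bold>+ b \<^bold>+ \<^bold>- (b \<^bold>+ z) \<in> K"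
      using LC[OF z] b q.proj_eq_iff by auto
    then show ?thesis using LC[OF z] b by (simp add: add_simps)
  qed
  moreover have "\<exists>y\<in>L. (\<forall>z\<in>L. \<exists>k. z \<^bold>+ \<^bold>- (k \<^bold>\<cdot> y) \<in> K) \<and> (\<forall>k. k \<^bold>\<cdot> y \<in> K \<longrightarrow> k = 0)"
  proof -
    let ?H = "A\<lparr>carrier := L\<rparr>"
    note subL = idealD(1)[OF L]
    interpret H: group ?H by (rule subgroup.subgroup_is_group[OF subL add.is_group])
    interpret KH: normal K ?H using add.normal_restrict_supergroup[OF subL idealD(3)[OF K] KL] .
    obtain \<phi> where \<phi>: "\<phi> \<in> iso (?H Mod K) integer_group" using iso unfolding is_iso_def by blast
    \<comment> \<open>The given isomorphism read as a homomorphism on \<open>L\<close> with kernel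
      \<open>K\<close>; a preimage of 1 is the generator sought.\<close>
    define \<psi> where "\<psi> = (\<lambda>x. \<phi> (K #>\<^bsub>?H\<^esub> x))"
    have hom: "\<psi> \<in> hom ?H integer_group"
      using hom_compose[OF KH.r_coset_hom_Mod] \<phi> unfolding \<psi>_def iso_def comp_def by blast
    interpret \<psi>: group_hom ?H integer_group \<psi>
      using hom H.is_group by (simp add: group_hom_def group_hom_axioms_def)
    have carr: "carrier (?H Mod K) = (\<lambda>x. K #>\<^bsub>?H\<^esub> x) ` L" by (auto simp: FactGroup_def RCOSETS_def)
    have bij: "bij_betw \<phi> ((\<lambda>x. K #>\<^bsub>?H\<^esub> x) ` L) UNIV" using \<phi> unfolding iso_def carr by simp
    then have "1 \<in> \<phi> ` ((\<lambda>x. K #>\<^bsub>?H\<^esub> x) ` L)" unfolding bij_betw_def by blast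
    then obtain y where y: "y \<in> L" "\<psi> y = 1" unfolding \<psi>_def by auto
    have pow: "\<psi> (k \<^bold>\<cdot> x) = k * \<psi> x" if "x \<in> L" for k x
      using \<psi>.hom_int_pow[of x k] that add.int_pow_consistent[OF subL, of x k] by simp
    have add: "\<psi> (a \<^bold>+ b) = \<psi> a + \<psi> b" if "a \<in> L" "b \<in> L" for a b
      using \<psi>.hom_mult[of a b] that by simp
    have ker: "x \<in> K" if x: "x \<in> L" "\<psi> x = 0" for x
    proof -
      have "\<psi> \<^bold>0 = 0" using \<psi>.hom_one by simp
      then have "\<phi> (K #>\<^bsub>?H\<^esub> x) = \<phi> (K #>\<^bsub>?H\<^esub> \<^bold>0)" using x unfolding \<psi>_def by simp
      then have "K #>\<^bsub>?H\<^esub> x = K #>\<^bsub>?H\<^esub> \<^bold>0"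
        using bij x(1) idealD(6)[OF L] unfolding bij_betw_def by (meson image_eqI inj_onD)
      then have "q x = q \<^bold>0" unfolding q_def r_coset_def by simp
      then show ?thesis using q.proj_eq_iff[of x "\<^bold>0"] LC[OF x(1)] by simp
    qed
    have ker0: "\<psi> x = 0" if x: "x \<in> K" for x
    proof -
      have "K #>\<^bsub>?H\<^esub> x = K" using KH.rcos_const[OF H.is_group x] .
      moreover have "K #>\<^bsub>?H\<^esub> \<^bold>0 = K" using KH.rcos_const[OF H.is_group idealD(6)[OF K]] .
      ultimately have "\<psi> x = \<psi> \<^bold>0" unfolding \<psi>_def by simp
      then show ?thesis using \<psi>.hom_one by simp
    qed
    have "\<exists>k. z \<^bold>+ \<^bold>- (k \<^bold>\<cdot> y) \<in> K" if z: "z \<in> L" for z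
    proof -
      have "\<psi> (z \<^bold>+ (- \<psi> z) \<^bold>\<cdot> y) = 0"
        using add[OF z idealD(13)[OF L y(1)]] pow[OF y(1)] y(2) by simp
      then have "z \<^bold>+ (- \<psi> z) \<^bold>\<cdot> y \<in> K" using ker idealD(11)[OF L z idealD(13)[OF L y(1)]] by blast
      then show ?thesis using LC[OF y(1)] by (auto simp: add.int_pow_neg)
    qed
    moreover have "k = 0" if "k \<^bold>\<cdot> y \<in> K" for k
      using ker0[OF that] pow[OF y(1)] y(2) by simp
    ultimately show ?thesis using y(1) by blast
  qed
  ultimately show ?thesis unfolding infinite_factor_def using K L KL by blast
qed

end

text \<open>A factor of prime order above \<open>p\<close> is pushed down the chain already built.
  The bound on the spectrum forbids its arrival at 0, so it has been absorbed and leaves a chain of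
  the required kind.\<close>

lemma supersoluble_factor_chain:
  assumes ss: "supersoluble_brace A M" and p: "2 \<le> p" "\<forall>r\<in>add_prime_spectrum A. r \<le> p"
  shows "\<exists>h. factor_chain p A M h {\<^bold>0} C"
proof -
  obtain I n where I: "I 0 = {\<^bold>0}" "I n = C" "\<forall>i\<le>n. ideal (I i)"
    and step: "\<forall>i<n. I i \<subseteq> I (Suc i) \<and>
           ((((A\<lparr>carrier := I (Suc i)\<rparr>) Mod (I i)) \<cong> integer_group \<and>
             (\<lambda>x. I i #>\<^bsub>A\<^esub> x) ` I (Suc i) \<subseteq> brace_socle (A Mod (I i)) (M Mod (I i)))
            \<or> Factorial_Ring.prime (card ((\<lambda>x. I i #>\<^bsub>A\<^esub> x) ` I (Suc i))))"
    using ss unfolding supersoluble_brace_def by (elim conjE exE) (rule that)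
  have "\<exists>h. factor_chain p A M h {\<^bold>0} (I i)" if "i \<le> n" for i
    using that
  proof (induction i)
    case 0
    then show ?case using I(1) ideal_zero factor_chain.refl by metis
  next
    case (Suc i)
    then obtain h where h: "factor_chain p A M h {\<^bold>0} (I i)" by auto
    have id: "ideal (I i)" "ideal (I (Suc i))" and sub: "I i \<subseteq> I (Suc i)"
      using I(3)[rule_format] step[rule_format, of i] Suc.prems by auto
    let ?q = "(\<lambda>x. I i #>\<^bsub>A\<^esub> x) ` I (Suc i)"
    consider "infinite_factor A M (I i) (I (Suc i))" | "Factorial_Ring.prime (card ?q)"
      using step[rule_format, of i] Suc.prems infinite_factor_cosets[OF id sub] by auto
    then show ?case
    proof cases
      case 1
      then show ?thesis using factor_chain.infinite[OF h] by blast
    next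
      case 2
      show ?thesis
      proof (cases "card ?q \<le> p")
        case True
        have "finite ?q" using 2 by (metis card.infinite not_prime_0)
        then have "small_factor p A M (I i) (I (Suc i))" using small_factor_cosets[OF id sub] True by blast
        then show ?thesis using factor_chain.small[OF h] by blast
      next
        case False
        then have r: "p < card ?q" "odd (card ?q)" using p(1) 2 prime_odd_nat by auto
        obtain K' h' where K': "K' = {\<^bold>0} \<or> prime_factor (card ?q) A M {\<^bold>0} K'"
            "factor_chain p A M h' K' (I (Suc i))"
          using push_prime_factor[OF 2 r(2,1) h prime_factor_cosets[OF id sub 2]] by blast
        have "\<not> prime_factor (card ?q) A M {\<^bold>0} K'"
          using prime_factor_zero_spectrum[OF _ 2] p(2) False by blast
        then show ?thesis using K' by blast
      qed
    qed
  qed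
  then show ?thesis using I(2) by (metis order_refl)
qed

end

theorem theorem3p25:
  fixes A :: "('a, 'm) monoid_scheme" and M :: "('a, 'n) monoid_scheme" and p :: nat
  assumes "supersoluble_brace A M"
    and "p \<in> add_prime_spectrum A \<union> {2}"
    and "\<forall>r\<in>add_prime_spectrum A \<union> {2}. r \<le> p"
  shows "\<Inter> {I. brace_ideal A M I \<and> finite (carrier (A Mod I)) \<and>
             (\<forall>q. Factorial_Ring.prime q \<and> q dvd card (carrier (A Mod I)) \<longrightarrow> q \<le> p)}
         = {\<one>\<^bsub>A\<^esub>}"
    (is "\<Inter> ?F = _")
proof -
  interpret skew_brace A M
    using assms(1) by unfold_locales (simp add: supersoluble_brace_def)
  have F: "I \<in> ?F" if "factor_chain p A M 0 I C" for I
    using that finite_quotient[OF that] factor_chain_ideals[OF that] by blast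
  have p: "2 \<le> p" "\<forall>r\<in>add_prime_spectrum A. r \<le> p" using assms(3) by auto
  obtain h where h: "factor_chain p A M h {\<^bold>0} C"
    using supersoluble_factor_chain[OF assms(1) p] by blast
  show ?thesis
  proof
    show "{\<^bold>0} \<subseteq> \<Inter> ?F" using idealD(6) by blast
    \<comment> \<open>Membership of the carrier in the family confines the intersection to the
      carrier, where the separation below applies.\<close>
    have "C \<in> ?F" using F factor_chain.refl ideal_carrier by blast
    moreover have "\<exists>I\<in>?F. x \<notin> I" if "x \<in> C" "x \<noteq> \<^bold>0" for x
      using residually_small[OF p(1) h that(1)] that(2) F by blast
    ultimately show "\<Inter> ?F \<subseteq> {\<^bold>0}" by blast
  qed
qed

end
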